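(* Let $\xi,\nu,\mu\in\mathbb{C}$ with $\operatorname{Re}\mu<\frac12$, and let $\theta\in(0,\pi)$. Then $$\frac{P_{\nu-\frac12}^{\mu}(\cos\theta)}{\sqrt{\pi}\,\sin^{\mu}\theta}=\frac{\xi^{\mu+\frac32}}{2^{\frac{2\mu+7}{4}}}\int_0^{\theta}\widehat{\chi}_\nu(\xi,u)\,\frac{J_{-\mu-\frac12}\left(\xi\sqrt{2(\cos u-\cos\theta)}\right)}{(\cos u-\cos\theta)^{\frac{1+2\mu}{4}}}\,du$$ $$=\frac{\xi^{\mu+\frac32}}{2^{\frac{2\mu+7}{4}}}\int_{-\theta}^{\theta}\chi_{\nu+1,\nu}(\xi,u)\,\frac{J_{-\mu-\frac12}\left(\xi\sqrt{2(\cos u-\cos\theta)}\right)}{e^{iu/2}(\cos u-\cos\theta)^{\frac{1+2\mu}{4}}}\,du,$$ where $\widehat{\chi}_\nu(\xi,u)=e^{-iu/2}\chi_{\nu+1,\nu}(\xi,u)+e^{iu/2}\chi_{\nu+1,\nu}(\xi,-u)$.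
   Context: For $x\in(-1,1)$ and $\nu,\mu\in\mathbb{C}$ the Ferrers function of the first kind is $P_\nu^{-\mu}(x)=\left(\frac{1-x}{1+x}\right)^{\mu/2}\frac{F(-\nu,\nu+1;1+\mu;\frac{1-x}{2})}{\Gamma(1+\mu)}$, where $F$ is the Gauss hypergeometric function and $F(a,b;c;z)/\Gamma(c)$ is read as $\sum_k \frac{(a)_k(b)_k}{\Gamma(c+k)k!}z^k$, entire in $c$; $P_\nu^{\sigma}$ denotes this function with $\mu=-\sigma$. $J_\sigma$ and $Y_\sigma$ are the Bessel functions of the first and second kind, and $$\chi_{\varkappa,\sigma}(\xi,u)=J_\varkappa(\xi e^{-iu/2})Y_\sigma(\xi e^{iu/2})-Y_\varkappa(\xi e^{-iu/2})J_\sigma(\xi e^{iu/2}).$$ For $\xi\neq0$ multivalued functions are evaluated with one fixed choice of $\arg\xi$ and with $\arg(\xi e^{\pm iu/2})=\arg\xi\pm u/2$; for $\xi=0$ the right-hand sides are understood as limits as $\xi\to0$. *)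

theory Defs
  imports "HOL-Analysis.Analysis"
begin

text \<open>Regularized Gauss series F(a,b;c;z)/Gamma(c), entire in c because rGamma is.\<close>

definition hyp2F1_reg :: "complex \<Rightarrow> complex \<Rightarrow> complex \<Rightarrow> complex \<Rightarrow> complex" where
  "hyp2F1_reg a b c z =
     (\<Sum>k. pochhammer a k * pochhammer b k * rGamma (c + of_nat k) / fact k * z ^ k)"

text \<open>The second argument is the upper index, so \<open>Ferrers_P \<nu> (- \<mu>) x\<close> is
  \<open>((1-x)/(1+x))\<close> to the power \<open>\<mu>/2\<close> times \<open>F(-\<nu>,\<nu>+1;1+\<mu>;(1-x)/2) / Gamma(1+\<mu>)\<close>.\<close>

definition Ferrers_P :: "complex \<Rightarrow> complex \<Rightarrow> real \<Rightarrow> complex" where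
  "Ferrers_P \<nu> \<sigma> x =
     of_real ((1 - x) / (1 + x)) powr (- \<sigma> / 2) *
     hyp2F1_reg (- \<nu>) (\<nu> + 1) (1 - \<sigma>) (of_real ((1 - x) / 2))"

text \<open>A nonzero argument z together with a choice of arg z is represented by the logarithm
  \<open>l = ln |z| + i arg z\<close>. All functions below are thus the full multivalued ones:
  the second parameter of the Bessel functions is l, not z = exp l, and adding \<open>i u/2\<close>
  to l is multiplication of z by \<open>exp (i u/2)\<close> with \<open>arg z\<close> increased by \<open>u/2\<close>.\<close>

definition Bessel_J :: "complex \<Rightarrow> complex \<Rightarrow> complex" where
  "Bessel_J \<sigma> l =
     exp (\<sigma> * (l - of_real (ln 2))) *
     (\<Sum>k. (-1) ^ k * rGamma (\<sigma> + of_nat k + 1) / fact k * (exp l / 2) ^ (2 * k))"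

definition Bessel_Y :: "complex \<Rightarrow> complex \<Rightarrow> complex" where
  "Bessel_Y \<sigma> l =
     (let q = (\<lambda>s. (Bessel_J s l * cos (of_real pi * s) - Bessel_J (- s) l) / sin (of_real pi * s))
      in if \<sigma> \<in> \<int> then Lim (at \<sigma>) q else q \<sigma>)"

definition Bessel_chi :: "complex \<Rightarrow> complex \<Rightarrow> complex \<Rightarrow> real \<Rightarrow> complex" where
  "Bessel_chi \<kappa> \<sigma> l u =
     Bessel_J \<kappa> (l - \<i> * of_real u / 2) * Bessel_Y \<sigma> (l + \<i> * of_real u / 2) -
     Bessel_Y \<kappa> (l - \<i> * of_real u / 2) * Bessel_J \<sigma> (l + \<i> * of_real u / 2)"

definition Bessel_chi_hat :: "complex \<Rightarrow> complex \<Rightarrow> real \<Rightarrow> complex" where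
  "Bessel_chi_hat \<nu> l u =
     exp (- (\<i> * of_real u / 2)) * Bessel_chi (\<nu> + 1) \<nu> l u +
     exp (\<i> * of_real u / 2) * Bessel_chi (\<nu> + 1) \<nu> l (- u)"

text \<open>The two integrands and right-hand sides, as functions of the logarithm l of \<open>\<xi>\<close>.
  The positive factor \<open>sqrt (2 * (cos u - cos \<theta>))\<close> leaves \<open>arg \<xi>\<close> unchanged; at the endpoints
  \<open>u = \<theta>\<close>, \<open>u = - \<theta>\<close>, where it vanishes, the values are irrelevant for the integrals.\<close>

definition integrand_hat :: "complex \<Rightarrow> complex \<Rightarrow> real \<Rightarrow> complex \<Rightarrow> real \<Rightarrow> complex" where
  "integrand_hat \<nu> \<mu> \<theta> l u =
     Bessel_chi_hat \<nu> l u *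
     (Bessel_J (- \<mu> - 1 / 2) (l + of_real (ln (sqrt (2 * (cos u - cos \<theta>))))) /
      of_real (cos u - cos \<theta>) powr ((1 + 2 * \<mu>) / 4))"

definition integrand_chi :: "complex \<Rightarrow> complex \<Rightarrow> real \<Rightarrow> complex \<Rightarrow> real \<Rightarrow> complex" where
  "integrand_chi \<nu> \<mu> \<theta> l u =
     Bessel_chi (\<nu> + 1) \<nu> l u *
     (Bessel_J (- \<mu> - 1 / 2) (l + of_real (ln (sqrt (2 * (cos u - cos \<theta>))))) /
      (exp (\<i> * of_real u / 2) * of_real (cos u - cos \<theta>) powr ((1 + 2 * \<mu>) / 4)))"

definition rhs_hat :: "complex \<Rightarrow> complex \<Rightarrow> real \<Rightarrow> complex \<Rightarrow> complex" where
  "rhs_hat \<nu> \<mu> \<theta> l =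
     exp ((\<mu> + 3 / 2) * l) / 2 powr ((2 * \<mu> + 7) / 4) *
     integral {0..\<theta>} (integrand_hat \<nu> \<mu> \<theta> l)"

definition rhs_chi :: "complex \<Rightarrow> complex \<Rightarrow> real \<Rightarrow> complex \<Rightarrow> complex" where
  "rhs_chi \<nu> \<mu> \<theta> l =
     exp ((\<mu> + 3 / 2) * l) / 2 powr ((2 * \<mu> + 7) / 4) *
     integral {- \<theta>..\<theta>} (integrand_chi \<nu> \<mu> \<theta> l)"

end

theory Submission
  imports Defs "HOL-Complex_Analysis.Complex_Analysis" "HOL-Real_Asymp.Real_Asymp"
begin

text \<open>Write \<open>\<sigma> = - \<mu> - 1/2\<close>, \<open>c = cos u - cos \<theta>\<close>, \<open>y = \<xi>\<^sup>2 / 4\<close> and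
  \<open>J\<^sub>s(z) = (z/2)\<^sup>s b\<^sub>s(z\<^sup>2/4)\<close> with \<open>b\<^sub>s\<close> entire, so that \<open>b\<^sub>s' = - b\<^sub>s\<^sub>+\<^sub>1\<close> and
  \<open>b\<^sub>s\<^sub>-\<^sub>1(w) = s b\<^sub>s(w) - w b\<^sub>s\<^sub>+\<^sub>1(w)\<close>. For \<open>\<nu>\<close> not an integer, the right-hand side becomes, up to a constant,
  the integral over \<open>[0, \<theta>]\<close> of \<open>S(y,u) c\<^sup>\<sigma> b\<^sub>\<sigma>(2yc)\<close>, where \<open>S(y,u) = r(u) + r(-u)\<close> is entire in \<open>y\<close>. With
  \<open>q(u) = e\<^sup>i\<^sup>\<nu>\<^sup>u b\<^sub>-\<^sub>\<nu>(y e\<^sup>-\<^sup>i\<^sup>u) b\<^sub>\<nu>(y e\<^sup>i\<^sup>u)\<close> one has \<open>\<partial>q/\<partial>u = - i r\<close> and \<open>\<partial>r/\<partial>y = 2 i sin(u) q\<close>; hence the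
  \<open>y\<close>-derivative of the integrand is the \<open>u\<close>-derivative of
  \<open>- 2 i (q(u) - q(-u)) c\<^sup>\<sigma>\<^sup>+\<^sup>1 b\<^sub>\<sigma>\<^sub>+\<^sub>1(2yc)\<close>, which vanishes at both endpoints. So the integral does not depend on
  \<open>\<xi>\<close>, and at \<open>\<xi> = 0\<close> it is the Mehler--Dirichlet integral of \<open>cos(\<nu> u) c\<^sup>\<sigma>\<close>. That one is evaluated by expanding
  \<open>cos(\<nu> u) / cos(u/2)\<close> as a hypergeometric series in \<open>sin\<^sup>2(u/2)\<close> and integrating termwise. Integer \<open>\<nu>\<close> follow by
  continuity in \<open>\<nu>\<close>.\<close>

section \<open>The Beta integral for complex parameters\<close>

text \<open>The modulus of the integrand is the real Beta integrand with parameters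
  \<open>Re a\<close> and \<open>Re b\<close>, which serves as the dominating function.\<close>

lemma set_integrable_Beta_complex:
  fixes a b :: complex
  assumes "Re a > 0" "Re b > 0"
  shows "set_integrable lborel {0<..<1} (\<lambda>t. of_real t powr (a - 1) * of_real (1 - t) powr (b - 1))"
proof -
  have "set_integrable lborel {0..1} (\<lambda>t. t powr (Re a - 1) * (1 - t) powr (Re b - 1))"
    by (rule integrable_Beta) (use assms in auto)
  then have R: "set_integrable lborel {0<..<1} (\<lambda>t. t powr (Re a - 1) * (1 - t) powr (Re b - 1))"
    by (rule set_integrable_subset) auto
  show ?thesis
    unfolding set_integrable_def
  proof (rule Bochner_Integration.integrable_bound[OF R[unfolded set_integrable_def]])
    show "AE x in lborel. norm (indicat_real {0<..<1} x *\<^sub>R (complex_of_real x powr (a - 1) * complex_of_real (1 - x) powr (b - 1)))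
        \<le> norm (indicat_real {0<..<1} x *\<^sub>R (x powr (Re a - 1) * (1 - x) powr (Re b - 1)))"
      by (intro AE_I2) (auto simp: indicator_def norm_mult norm_powr_real_powr abs_mult simp del: of_real_diff)
    have "(\<lambda>x. indicat_real {0<..<1} x *\<^sub>R (complex_of_real x powr (a - 1) * complex_of_real (1 - x) powr (b - 1)))
        \<in> borel_measurable borel"
      by (intro borel_measurable_continuous_on_indicator) (auto intro!: continuous_intros)
    then show "(\<lambda>x. indicat_real {0<..<1} x *\<^sub>R (complex_of_real x powr (a - 1) * complex_of_real (1 - x) powr (b - 1)))
        \<in> borel_measurable lborel"
      by (simp only: measurable_lborel2)
  qed
qed

text \<open>Convolution argument: \<open>Gamma a * Gamma b\<close> is the double integral of
  \<open>G a t * G b (u - t)\<close>. After Fubini, the substitution t = u s splits the inner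
  integral into \<open>G (a + b) u\<close> and the Beta integral, so integrating over u gives
  \<open>Gamma (a + b) * B\<close>.\<close>

lemma integral_Beta_complex:
  fixes a b :: complex
  assumes a: "Re a > 0" and b: "Re b > 0"
  shows "(LBINT t:{0<..<1}. complex_of_real t powr (a - 1) * of_real (1 - t) powr (b - 1)) = Beta a b"
proof -
  \<comment> \<open>The Gamma integrand is extended by zero to the whole line, so that the
    convolution needs no variable limits and the supports encode 0 < t < u.\<close>
  define G :: "complex \<Rightarrow> real \<Rightarrow> complex" where
    "G = (\<lambda>z t. indicat_real {0<..} t *\<^sub>R (of_real t powr (z - 1) / of_real (exp t)))"
  define B where "B = (LBINT t:{0<..<1}. complex_of_real t powr (a - 1) * of_real (1 - t) powr (b - 1))"
  have meas [measurable]: "G z \<in> borel_measurable borel" for z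
    unfolding G_def
    by (intro borel_measurable_continuous_on_indicator) (auto intro!: continuous_intros)
  have int: "integrable lborel (G z)" if "Re z > 0" for z
  proof -
    \<comment> \<open>Integrability is first obtained for the completed measure; Borel measurability
      of \<open>G z\<close> carries it over to \<open>lborel\<close>, where Fubini is
      applied.\<close>
    have "integrable (completion lborel) (G z)"
      using absolutely_integrable_Gamma_integral'[OF that] by (simp add: set_integrable_def G_def)
    then show ?thesis by (subst (asm) integrable_completion) (use meas in simp_all)
  qed
  have val: "(\<integral>t. G z t \<partial>lborel) = Gamma z" if "Re z > 0" for z
  proof -
    have "set_integrable lborel {0<..} (\<lambda>t. complex_of_real t powr (z - 1) / of_real (exp t))"
      using int[OF that] by (simp add: G_def set_integrable_def)
    from set_borel_integral_eq_integral(2)[OF this] Gamma_integral_complex'[OF that]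
    show ?thesis by (simp add: G_def set_lebesgue_integral_def integral_unique)
  qed
  have prod_int: "integrable (lborel \<Otimes>\<^sub>M lborel) (\<lambda>(t, u). G a t * G b (u - t))"
  proof (rule lborel_pair.Fubini_integrable)
    show "(\<lambda>(t, u). G a t * G b (u - t)) \<in> borel_measurable (lborel \<Otimes>\<^sub>M lborel)"
      by (simp add: split_beta) measurable
    have "(\<integral>u. norm (G a t * G b (u - t)) \<partial>lborel) = norm (G a t) * (\<integral>u. norm (G b u) \<partial>lborel)" for t
      using lborel_integral_real_affine[of 1 "\<lambda>u. norm (G b u)" "-t"] by (simp add: norm_mult)
    then show "integrable lborel (\<lambda>x. \<integral>y. norm (case (x, y) of (t, u) \<Rightarrow> G a t * G b (u - t)) \<partial>lborel)"
      using int[OF a] by simp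
    have "integrable lborel (\<lambda>u. G b (u - t))" for t
      using lborel_integrable_real_affine[OF int[OF b], of 1 "-t"] by simp
    then show "AE x in lborel. integrable lborel (\<lambda>y. case (x, y) of (t, u) \<Rightarrow> G a t * G b (u - t))"
      by simp
  qed
  have "Gamma a * Gamma b = (\<integral>t. G a t * Gamma b \<partial>lborel)"
    using val[OF a] by simp
  also have "\<dots> = (\<integral>t. (\<integral>u. G a t * G b (u - t) \<partial>lborel) \<partial>lborel)"
  proof (rule Bochner_Integration.integral_cong[OF refl])
    fix t
    show "G a t * Gamma b = (\<integral>u. G a t * G b (u - t) \<partial>lborel)"
      using lborel_integral_real_affine[of 1 "G b" "-t"] val[OF b] by simp
  qed
  also have "\<dots> = (\<integral>u. (\<integral>t. G a t * G b (u - t) \<partial>lborel) \<partial>lborel)"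
    using lborel_pair.Fubini_integral[OF prod_int] by simp
  also have "\<dots> = (\<integral>u. G (a + b) u * B \<partial>lborel)"
  proof (rule Bochner_Integration.integral_cong[OF refl])
    fix u :: real
    show "(\<integral>t. G a t * G b (u - t) \<partial>lborel) = G (a + b) u * B"
    proof (cases "u > 0")
      case False
      then have "(\<lambda>t. G a t * G b (u - t)) = (\<lambda>_. 0)" by (auto simp: G_def indicator_def)
      moreover have "G (a + b) u = 0" using False by (simp add: G_def)
      ultimately show ?thesis by (simp only:) simp
    next
      case True
      \<comment> \<open>Homogeneity gives the power a + b - 2 of u; the Jacobian factor u raises it
        to a + b - 1, the exponent in \<open>G (a + b) u\<close>.\<close>
      have eq: "G a (u * s) * G b (u - u * s) =
           of_real u powr (a + b - 2) / of_real (exp u) *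
           (indicat_real {0<..<1} s *\<^sub>R (complex_of_real s powr (a - 1) * of_real (1 - s) powr (b - 1)))" for s
      proof (cases "0 < s \<and> s < 1")
        case False
        then have "\<not> (0 < u * s \<and> 0 < u - u * s)"
          using True by (auto simp: zero_less_mult_iff)
        with False show ?thesis by (auto simp: G_def indicator_def)
      next
        case s: True
        have p1: "complex_of_real (u * s) powr (a - 1) = of_real u powr (a - 1) * of_real s powr (a - 1)"
          using s True by (simp add: powr_times_real)
        have "complex_of_real (u - u * s) = of_real u * of_real (1 - s)"
          by (simp add: algebra_simps)
        then have p2: "complex_of_real (u - u * s) powr (b - 1) = of_real u powr (b - 1) * of_real (1 - s) powr (b - 1)"
          using s True by (simp only:) (rule powr_times_real, auto)
        have p3: "complex_of_real u powr (a + b - 2) = of_real u powr (a - 1) * of_real u powr (b - 1)"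
          by (simp flip: powr_add add: algebra_simps)
        have e: "complex_of_real (exp u) = of_real (exp (u * s)) * of_real (exp (u - u * s))"
          by (simp flip: of_real_mult exp_add)
        have pos: "0 < u * s" "0 < u - u * s" using s True by auto
        show ?thesis
          using s pos unfolding G_def p1 p2 p3 e by simp
      qed
      have "(\<integral>t. G a t * G b (u - t) \<partial>lborel) = \<bar>u\<bar> *\<^sub>R (\<integral>s. G a (0 + u * s) * G b (u - (0 + u * s)) \<partial>lborel)"
        using True by (intro lborel_integral_real_affine) auto
      also have "\<dots> = u *\<^sub>R (of_real u powr (a + b - 2) / of_real (exp u) * B)"
        using True unfolding B_def set_lebesgue_integral_def by (simp only: add_0 eq integral_mult_right_zero) simp
      also have "\<dots> = (of_real u powr 1 * of_real u powr (a + b - 2)) / of_real (exp u) * B"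
        using True by (simp add: scaleR_conv_of_real)
      also have "complex_of_real u powr 1 * of_real u powr (a + b - 2) = of_real u powr (a + b - 1)"
        unfolding powr_add[symmetric] by (simp add: algebra_simps)
      finally show ?thesis using True by (simp add: G_def)
    qed
  qed
  also have "\<dots> = Gamma (a + b) * B"
    using val[of "a + b"] a b by simp
  finally have "Gamma a * Gamma b = Gamma (a + b) * B" .
  moreover have "Gamma (a + b) \<noteq> 0"
    using a b by (intro Gamma_nonzero) (auto elim!: nonpos_Ints_cases simp: complex_eq_iff)
  ultimately have "B = Beta a b" by (simp add: Beta_def field_simps)
  then show ?thesis by (simp add: B_def)
qed

section \<open>Entire part of the Bessel functions of the first kind\<close>

text \<open>The bound is uniform in k. For k up to N the arguments stay in a compact ball. Beyond N
  the recurrence rGamma z = z rGamma (z + 1) has |z| at least 1, so the moduli no longer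
  increase.\<close>

lemma rGamma_bounded:
  obtains M where "\<And>s k. norm (s::complex) \<le> R \<Longrightarrow> norm (rGamma (s + of_nat k + 1)) \<le> M"
proof -
  define N where "N = nat \<lceil>\<bar>R\<bar>\<rceil>"
  have N: "R \<le> real N" by (simp add: N_def) linarith
  have "compact (rGamma ` cball (0::complex) (R + real N + 1))"
    by (intro compact_continuous_image continuous_intros compact_cball)
  then obtain M where M: "\<And>z::complex. norm z \<le> R + real N + 1 \<Longrightarrow> norm (rGamma z) \<le> M"
    by (fastforce dest!: compact_imp_bounded simp: bounded_iff)
  have "norm (rGamma (s + of_nat k + 1)) \<le> M" if s: "norm s \<le> R" for s :: complex and k
  proof (induction k)
    case 0
    have "norm (s + 1) \<le> norm s + norm (1::complex)" by (rule norm_triangle_ineq)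
    with s show ?case by (intro M) simp
  next
    case (Suc k)
    show ?case
    proof (cases "Suc k \<le> N")
      case True
      have "norm (s + of_nat (Suc k) + 1) \<le> norm s + norm (of_nat (Suc k) + 1 :: complex)"
        unfolding add.assoc by (rule norm_triangle_ineq)
      also have "norm (of_nat (Suc k) + 1 :: complex) = real (Suc k) + 1"
        by (metis norm_of_nat of_nat_1 of_nat_add)
      finally show ?thesis using s True by (intro M) simp
    next
      case False
      have "real k + 1 = norm (of_nat (Suc k) :: complex)"
        by (metis norm_of_nat of_nat_Suc add.commute)
      also have "\<dots> \<le> norm (s + of_nat (Suc k)) + norm s"
        by (metis add_diff_cancel_left' norm_triangle_ineq4)
      finally have "1 \<le> norm (s + of_nat k + 1)"
        using s N False by (simp add: add_ac)
      moreover have "rGamma (s + of_nat k + 1) = (s + of_nat k + 1) * rGamma (s + of_nat k + 1 + 1)"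
        by (rule rGamma_plus1[symmetric])
      ultimately have "norm (rGamma (s + of_nat k + 1 + 1)) \<le> norm (rGamma (s + of_nat k + 1))"
        by (simp add: norm_mult mult_le_cancel_right1)
      then show ?thesis using Suc by (simp add: add_ac)
    qed
  qed
  then show thesis by (rule that)
qed

text \<open>The Bessel-Clifford function at -w, called \<open>b\<^sub>s\<close> in the introduction.
  Stripping the power (z/2)^s from J leaves a single-valued function, entire in order and
  argument.\<close>

definition bes :: "complex \<Rightarrow> complex \<Rightarrow> complex" where
  "bes s w = (\<Sum>k. (- 1) ^ k * rGamma (s + of_nat k + 1) / fact k * w ^ k)"

lemma continuous_on_rGamma' [continuous_intros]:
  "continuous_on A f \<Longrightarrow> continuous_on A (\<lambda>x. rGamma (f x))"
  by (rule continuous_on_compose2[OF continuous_on_rGamma[of UNIV]]) auto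

text \<open>Weierstrass test with majorant M W^k / k!, where M bounds rGamma uniformly in k.
  Uniformity in both variables at once is what yields joint continuity and holomorphy in the
  order.\<close>

lemma uniform_limit_bes:
  "uniform_limit (cball 0 R \<times> cball 0 W)
     (\<lambda>n (s, w). \<Sum>k<n. (- 1) ^ k * rGamma (s + of_nat k + 1) / fact k * w ^ k)
     (\<lambda>(s, w). bes s w) sequentially"
proof -
  obtain M where M: "\<And>s k. norm (s::complex) \<le> R \<Longrightarrow> norm (rGamma (s + of_nat k + 1)) \<le> M"
    using rGamma_bounded[of R] by blast
  have "uniform_limit (cball 0 R \<times> cball 0 W)
     (\<lambda>n (x :: complex \<times> complex). \<Sum>k<n. (- 1) ^ k * rGamma (fst x + of_nat k + 1) / fact k * snd x ^ k)
     (\<lambda>x. \<Sum>k. (- 1) ^ k * rGamma (fst x + of_nat k + 1) / fact k * snd x ^ k) sequentially"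
  proof (rule Weierstrass_m_test)
    show "summable (\<lambda>k. M * (inverse (fact k) * W ^ k))"
      using summable_exp by (rule summable_mult)
    fix k :: nat and x :: "complex \<times> complex" assume "x \<in> cball 0 R \<times> cball 0 W"
    then have "norm (rGamma (fst x + of_nat k + 1)) \<le> M" "norm (snd x) \<le> W"
      using M by auto
    then have "norm (rGamma (fst x + of_nat k + 1)) * (inverse (fact k) * norm (snd x) ^ k) \<le> M * (inverse (fact k) * W ^ k)"
      by (intro mult_mono mult_left_mono power_mono) (auto intro: order_trans[OF norm_ge_zero])
    then show "norm ((- 1) ^ k * rGamma (fst x + of_nat k + 1) / fact k * snd x ^ k) \<le> M * (inverse (fact k) * W ^ k)"
      by (simp add: norm_mult norm_divide norm_power divide_simps)
  qed
  then show ?thesis by (simp add: bes_def case_prod_beta')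
qed

lemma sums_bes: "(\<lambda>k. (- 1) ^ k * rGamma (s + of_nat k + 1) / fact k * w ^ k) sums bes s w"
  using tendsto_uniform_limitI[OF uniform_limit_bes, of "(s, w)" "norm s" "norm w"]
  by (simp add: sums_def)

lemma continuous_on_bes: "continuous_on UNIV (\<lambda>(s, w). bes s w)"
proof -
  have "continuous_on (cball 0 R \<times> cball 0 W) (\<lambda>(s, w). bes s w)" for R W
    by (rule uniform_limit_theorem[OF _ uniform_limit_bes])
       (auto intro!: always_eventually continuous_intros simp: split_beta)
  then have "isCont (\<lambda>(s, w). bes s w) (s, w)" for s w
    by (rule continuous_on_interior[of "cball 0 (norm s + 1) \<times> cball 0 (norm w + 1)"])
       (auto simp: interior_Times)
  then show ?thesis by (auto intro!: continuous_at_imp_continuous_on)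
qed

lemma continuous_on_bes' [continuous_intros]:
  assumes "continuous_on A f" "continuous_on A h"
  shows "continuous_on A (\<lambda>x. bes (f x) (h x))"
  using continuous_on_compose2[OF continuous_on_bes continuous_on_Pair[OF assms]] by simp

text \<open>Each partial sum is holomorphic in s because rGamma is entire, and the convergence is
  uniform on closed discs.\<close>

lemma holomorphic_bes_order: "(\<lambda>s. bes s w) holomorphic_on UNIV"
proof -
  have "(\<lambda>s. bes s w) holomorphic_on ball z 1" for z
  proof -
    have "uniform_limit (cball z 1)
       (\<lambda>n s. \<Sum>k<n. (- 1) ^ k * rGamma (s + of_nat k + 1) / fact k * w ^ k) (\<lambda>s. bes s w) sequentially"
    proof -
      have "norm s \<le> norm z + 1" if "dist z s \<le> 1" for s
        using that norm_triangle_ineq2[of s z] by (simp add: dist_norm norm_minus_commute)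
      then have "(\<lambda>s. (s, w)) \<in> cball z 1 \<rightarrow> cball 0 (norm z + 1) \<times> cball 0 (norm w)"
        by auto
      from uniform_limit_compose'[OF uniform_limit_bes this] show ?thesis by simp
    qed
    then show ?thesis
      by (rule holomorphic_uniform_limit[rotated])
         (auto intro!: always_eventually holomorphic_intros continuous_intros)
  qed
  then have "(\<lambda>s. bes s w) holomorphic_on (\<Union>z. ball z 1)"
    by (intro holomorphic_on_UN_open) auto
  moreover have "(\<Union>z::complex. ball z 1) = UNIV" by auto
  ultimately show ?thesis by simp
qed

lemma has_field_derivative_bes: "(bes s has_field_derivative - bes (s + 1) w) (at w)"
proof -
  define c where "c k = (- 1) ^ k * rGamma (s + of_nat k + 1) / fact k" for k
  have "summable (\<lambda>k. c k * w ^ k)" for w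
    using sums_bes[of s w] by (auto simp: c_def sums_iff)
  then have "((\<lambda>w. \<Sum>k. c k * w ^ k) has_field_derivative (\<Sum>k. diffs c k * w ^ k)) (at w)"
    by (rule termdiffs_strong_converges_everywhere)
  moreover have "(\<lambda>w. \<Sum>k. c k * w ^ k) = bes s"
    by (simp add: bes_def c_def fun_eq_iff)
  moreover have "diffs c k * w ^ k = - ((- 1) ^ k * rGamma (s + 1 + of_nat k + 1) / fact k * w ^ k)" for k
    using of_nat_neq_0[of k, where 'a = complex] by (auto simp: diffs_def c_def divide_simps add_ac)
  then have "(\<Sum>k. diffs c k * w ^ k) = - bes (s + 1) w"
    using sums_minus[OF sums_bes[of "s + 1" w]] by (simp add: sums_iff)
  ultimately show ?thesis by simp
qed

text \<open>Coefficientwise this is rGamma (s + k) = (s + k) rGamma (s + k + 1): the summand s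
  reproduces \<open>bes s\<close>, and the summand k acts as w d/dw, which gives - w
  \<open>bes (s + 1)\<close>.\<close>

lemma bes_contiguous: "bes (s - 1) w = s * bes s w - w * bes (s + 1) w"
proof -
  define c where "c k = (- 1) ^ k * rGamma (s + of_nat k + 1) / fact k" for k
  have "of_nat (Suc k) * c (Suc k) * w ^ k = - ((- 1) ^ k * rGamma (s + 1 + of_nat k + 1) / fact k * w ^ k)" for k
    using of_nat_neq_0[of k, where 'a = complex] by (auto simp: c_def divide_simps add_ac)
  then have "(\<lambda>k. of_nat (Suc k) * c (Suc k) * w ^ k) sums (- bes (s + 1) w)"
    using sums_minus[OF sums_bes[of "s + 1" w]] by simp
  then have "(\<lambda>k. w * (of_nat (Suc k) * c (Suc k) * w ^ k)) sums (w * (- bes (s + 1) w))"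
    by (rule sums_mult)
  then have "(\<lambda>k. of_nat (Suc k) * c (Suc k) * w ^ Suc k) sums (w * (- bes (s + 1) w))"
    by (simp add: mult_ac)
  then have "(\<lambda>k. of_nat k * c k * w ^ k) sums (w * (- bes (s + 1) w))"
    by (subst (asm) sums_Suc_iff) simp
  moreover have "(\<lambda>k. s * (c k * w ^ k)) sums (s * bes s w)"
    unfolding c_def by (intro sums_mult sums_bes)
  ultimately have "(\<lambda>k. s * (c k * w ^ k) + of_nat k * c k * w ^ k) sums (s * bes s w + w * (- bes (s + 1) w))"
    by (intro sums_add)
  moreover have "s * (c k * w ^ k) + of_nat k * c k * w ^ k = (- 1) ^ k * rGamma (s - 1 + of_nat k + 1) / fact k * w ^ k" for k
  proof -
    have e: "s - 1 + of_nat k + 1 = s + of_nat k" by simp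
    show ?thesis
      unfolding e rGamma_plus1[of "s + of_nat k", symmetric] by (simp add: c_def field_simps)
  qed
  ultimately show ?thesis
    using sums_bes[of "s - 1" w] by (simp add: sums_unique2)
qed

lemma bes_0: "bes s 0 = rGamma (s + 1)"
proof -
  have "(\<lambda>k. (- 1) ^ k * rGamma (s + of_nat k + 1) / fact k * 0 ^ k) sums ((- 1) ^ 0 * rGamma (s + of_nat 0 + 1) / fact 0)"
    using powser_sums_zero[of "\<lambda>k. (- 1) ^ k * rGamma (s + of_nat k + 1) / fact k"] by simp
  then show ?thesis using sums_bes[of s 0] by (simp add: sums_unique2)
qed

text \<open>The first n coefficients vanish because rGamma is zero at the nonpositive integers; the
  remaining series is the one of order n, shifted by n places.\<close>

lemma bes_neg_nat: "bes (- of_nat n) w = (- w) ^ n * bes (of_nat n) w"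
proof -
  define f where "f k = (- 1) ^ k * rGamma (- of_nat n + of_nat k + 1) / fact k * w ^ k" for k
  have z: "f k = 0" if "k < n" for k
  proof -
    have "- of_nat n + of_nat k + 1 = - (of_nat (n - k - 1) :: complex)"
      using that by (simp add: of_nat_diff algebra_simps)
    then have "rGamma (- of_nat n + of_nat k + 1 :: complex) = 0"
      by (simp add: rGamma_eq_zero_iff)
    then show ?thesis by (simp add: f_def)
  qed
  have "f sums bes (- of_nat n) w"
    using sums_bes[of "- of_nat n" w] by (simp add: f_def [abs_def])
  then have "(\<lambda>k. f (k + n)) sums bes (- of_nat n) w"
    using z by (subst sums_iff_shift) simp
  moreover have "f (k + n) = (- w) ^ n * ((- 1) ^ k * rGamma (of_nat n + of_nat k + 1) / fact k * w ^ k)" for k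
  proof -
    have "rGamma (- of_nat n + of_nat (k + n) + 1 :: complex) = inverse (fact k)"
      by (simp add: Gamma_fact rGamma_inverse_Gamma algebra_simps)
    moreover have "rGamma (of_nat n + of_nat k + 1 :: complex) = inverse (fact (k + n))"
      using Gamma_fact[of "k + n", where 'a = complex] by (simp add: rGamma_inverse_Gamma algebra_simps)
    ultimately show ?thesis
      by (simp add: f_def power_add power_minus[of w] field_simps)
  qed
  moreover have "(\<lambda>k. (- w) ^ n * ((- 1) ^ k * rGamma (of_nat n + of_nat k + 1) / fact k * w ^ k)) sums ((- w) ^ n * bes (of_nat n) w)"
    by (intro sums_mult sums_bes)
  ultimately show ?thesis by (simp add: sums_unique2)
qed

lemma Bessel_J_eq_bes: "Bessel_J s l = exp (s * (l - of_real (ln 2))) * bes s ((exp l / 2)\<^sup>2)"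
  by (simp add: Bessel_J_def bes_def power_mult add_ac)

section \<open>Independence of \<open>\<xi>\<close>\<close>

text \<open>The functions \<open>q\<close> and \<open>r\<close> of the introduction, for complex \<open>u\<close>.\<close>

definition bprod :: "complex \<Rightarrow> complex \<Rightarrow> complex \<Rightarrow> complex" where
  "bprod \<nu> y u = exp (\<i> * \<nu> * u) * bes (- \<nu>) (y * exp (- (\<i> * u))) * bes \<nu> (y * exp (\<i> * u))"

definition bprod' :: "complex \<Rightarrow> complex \<Rightarrow> complex \<Rightarrow> complex" where
  "bprod' \<nu> y u = exp (\<i> * \<nu> * u) *
     (bes (- \<nu> - 1) (y * exp (- (\<i> * u))) * bes \<nu> (y * exp (\<i> * u)) +
      y * exp (\<i> * u) * bes (- \<nu>) (y * exp (- (\<i> * u))) * bes (\<nu> + 1) (y * exp (\<i> * u)))"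

lemma has_field_derivative_bes' [derivative_intros]:
  assumes "(h has_field_derivative h') (at x within A)"
  shows "((\<lambda>x. bes s (h x)) has_field_derivative (- bes (s + 1) (h x) * h')) (at x within A)"
  by (rule DERIV_chain2[OF has_field_derivative_bes assms])

text \<open>The exponential contributes a term with factor \<nu>. The contiguous relation at order -
  \<nu> merges it with the derivative of the first Bessel factor into order - \<nu> - 1.\<close>

lemma bprod_deriv_u: "(bprod \<nu> y has_field_derivative - \<i> * bprod' \<nu> y u) (at u)"
proof -
  define E F A B where "E = exp (\<i> * \<nu> * u)" and "F = exp (\<i> * u)"
    and "A = y * exp (- (\<i> * u))" and "B = y * F"
  have c: "bes (- \<nu> - 1) A = - \<nu> * bes (- \<nu>) A - A * bes (1 - \<nu>) A"
    using bes_contiguous[of "- \<nu>" A] by simp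
  have "(bprod \<nu> y has_field_derivative
      (E * (\<i> * \<nu>) * bes (- \<nu>) A + E * (- bes (1 - \<nu>) A * (- \<i> * A))) * bes \<nu> B
      + E * bes (- \<nu>) A * (- bes (\<nu> + 1) B * (\<i> * B))) (at u)"
    unfolding bprod_def [abs_def] E_def F_def A_def B_def
    by (auto intro!: derivative_eq_intros simp: algebra_simps)
  moreover have "(E * (\<i> * \<nu>) * bes (- \<nu>) A + E * (- bes (1 - \<nu>) A * (- \<i> * A))) * bes \<nu> B
      + E * bes (- \<nu>) A * (- bes (\<nu> + 1) B * (\<i> * B)) = - \<i> * bprod' \<nu> y u"
    unfolding bprod'_def E_def[symmetric] F_def[symmetric] A_def[symmetric] B_def[symmetric] c
    by (simp add: algebra_simps)
  ultimately show ?thesis by simp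
qed

text \<open>The contiguous relations at orders - \<nu> and \<nu> + 1 eliminate the orders 1 - \<nu>
  and \<nu> + 2. All mixed terms then cancel, leaving \<open>bprod\<close> times exp (i u) - exp (-
  i u).\<close>

lemma bprod'_deriv_y: "((\<lambda>y. bprod' \<nu> y u) has_field_derivative 2 * \<i> * sin u * bprod \<nu> y u) (at y)"
proof -
  define E F G A B where "E = exp (\<i> * \<nu> * u)" and "F = exp (\<i> * u)" and "G = exp (- (\<i> * u))"
    and "A = y * G" and "B = y * F"
  have FG: "F * G = 1" by (simp add: F_def G_def flip: exp_add)
  have s: "2 * \<i> * sin u = F - G"
    by (simp add: sin_exp_eq F_def G_def)
  have c1: "bes (- \<nu> - 1) A = - \<nu> * bes (- \<nu>) A - A * bes (1 - \<nu>) A"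
    using bes_contiguous[of "- \<nu>" A] by simp
  have c2: "bes \<nu> B = (\<nu> + 1) * bes (\<nu> + 1) B - B * bes (\<nu> + 1 + 1) B"
    using bes_contiguous[of "\<nu> + 1" B] by simp
  have "((\<lambda>y. bprod' \<nu> y u) has_field_derivative
      E * ((- bes (- \<nu>) A * G) * bes \<nu> B + bes (- \<nu> - 1) A * (- bes (\<nu> + 1) B * F)
        + F * bes (- \<nu>) A * bes (\<nu> + 1) B
        + y * F * (- bes (1 - \<nu>) A * G) * bes (\<nu> + 1) B
        + y * F * bes (- \<nu>) A * (- bes (\<nu> + 1 + 1) B * F))) (at y)"
    unfolding bprod'_def [abs_def] E_def F_def G_def A_def B_def
    by (auto intro!: derivative_eq_intros simp: algebra_simps)
  moreover have "E * ((- bes (- \<nu>) A * G) * bes \<nu> B + bes (- \<nu> - 1) A * (- bes (\<nu> + 1) B * F)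
        + F * bes (- \<nu>) A * bes (\<nu> + 1) B
        + y * F * (- bes (1 - \<nu>) A * G) * bes (\<nu> + 1) B
        + y * F * bes (- \<nu>) A * (- bes (\<nu> + 1 + 1) B * F)) = (F - G) * (E * bes (- \<nu>) A * bes \<nu> B)"
  proof -
    have e: "y * F * (- bes (1 - \<nu>) A * G) = F * (bes (- \<nu> - 1) A + \<nu> * bes (- \<nu>) A)"
      unfolding c1 using FG by (simp add: A_def algebra_simps)
    have e': "y * F * bes (- \<nu>) A * (- bes (\<nu> + 1 + 1) B * F) = F * bes (- \<nu>) A * (bes \<nu> B - (\<nu> + 1) * bes (\<nu> + 1) B)"
      unfolding c2 by (simp add: B_def algebra_simps)
    show ?thesis unfolding e e' by (simp add: algebra_simps)
  qed
  moreover have "(F - G) * (E * bes (- \<nu>) A * bes \<nu> B) = 2 * \<i> * sin u * bprod \<nu> y u"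
    unfolding s bprod_def by (simp add: E_def F_def G_def A_def B_def)
  ultimately show ?thesis by simp
qed

lemma continuous_on_bprod [continuous_intros]:
  assumes "continuous_on S f" "continuous_on S h"
  shows "continuous_on S (\<lambda>x. bprod \<nu> (f x) (h x))"
  unfolding bprod_def by (intro continuous_intros assms)

lemma continuous_on_bprod' [continuous_intros]:
  assumes "continuous_on S f" "continuous_on S h"
  shows "continuous_on S (\<lambda>x. bprod' \<nu> (f x) (h x))"
  unfolding bprod'_def by (intro continuous_intros assms)

lemma has_vector_derivative_powr_of_real:
  assumes "(c has_real_derivative c') (at u within S)" "c u > 0"
  shows "((\<lambda>u. complex_of_real (c u) powr s) has_vector_derivative
            s * complex_of_real (c u) powr (s - 1) * of_real c') (at u within S)"
proof -
  have "((\<lambda>z. z powr s) has_field_derivative s * complex_of_real (c u) powr (s - 1)) (at (of_real (c u)))"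
    by (rule has_field_derivative_powr) (use assms in auto)
  moreover have "((\<lambda>u. complex_of_real (c u)) has_vector_derivative of_real c') (at u within S)"
    using assms(1) by (intro has_vector_derivative_of_real) (simp add: has_real_derivative_iff_has_vector_derivative)
  ultimately have "(((\<lambda>z. z powr s) \<circ> (\<lambda>u. complex_of_real (c u))) has_vector_derivative
      of_real c' * (s * complex_of_real (c u) powr (s - 1))) (at u within S)"
    by (intro field_vector_diff_chain_within[OF _ has_field_derivative_at_within])
  then show ?thesis by (simp add: o_def mult_ac)
qed

text \<open>Used to split integrands into a continuous, hence bounded and measurable, factor and one
  fixed factor that carries the endpoint singularity.\<close>

lemma absolutely_integrable_continuous_times:
  fixes f g :: "real \<Rightarrow> complex"
  assumes "continuous_on {a..b} f" "g absolutely_integrable_on {a..b}"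
  shows "(\<lambda>x. f x * g x) absolutely_integrable_on {a..b}"
proof (rule absolutely_integrable_bounded_measurable_product[where h = times and f = f and g = g])
  show "bilinear (times :: complex \<Rightarrow> complex \<Rightarrow> complex)" by (rule bilinear_times)
  show "f \<in> borel_measurable (lebesgue_on {a..b})"
    by (intro continuous_imp_measurable_on_sets_lebesgue assms) auto
  show "bounded (f ` {a..b})"
    by (intro compact_imp_bounded compact_continuous_image assms) auto
qed (use assms in auto)

lemma cos_diff_pos:
  assumes "\<bar>u\<bar> < \<theta>" "\<theta> < pi"
  shows "cos u - cos \<theta> > 0"
  using cos_monotone_0_pi[of "\<bar>u\<bar>" \<theta>] assms by simp

section \<open>The y-derivative of the integrand as a u-derivative\<close>

text \<open>The function S(y,u) times \<open>c\<^sup>\<sigma> b\<^sub>\<sigma>(2yc)\<close> of the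
  introduction, with y standing for \<xi> squared over 4.\<close>

definition bprod_integrand :: "complex \<Rightarrow> complex \<Rightarrow> real \<Rightarrow> complex \<Rightarrow> real \<Rightarrow> complex" where
  "bprod_integrand \<nu> \<sigma> \<theta> y u =
     (bprod' \<nu> y (of_real u) + bprod' \<nu> y (- of_real u)) * bes \<sigma> (2 * y * of_real (cos u - cos \<theta>)) *
     of_real (cos u - cos \<theta>) powr \<sigma>"

text \<open>It vanishes at u = 0 because the difference of the two \<open>bprod\<close> values is
  odd in u. At u = \<theta> it vanishes through the last power.\<close>

definition bprod_primitive :: "complex \<Rightarrow> complex \<Rightarrow> real \<Rightarrow> complex \<Rightarrow> real \<Rightarrow> complex" where
  "bprod_primitive \<nu> \<sigma> \<theta> y u =
     - 2 * \<i> * (bprod \<nu> y (of_real u) - bprod \<nu> y (- of_real u)) *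
     bes (\<sigma> + 1) (2 * y * of_real (cos u - cos \<theta>)) * of_real (cos u - cos \<theta>) powr (\<sigma> + 1)"

text \<open>The common value of the y-derivative of \<open>bprod_integrand\<close> and the
  u-derivative of \<open>bprod_primitive\<close>.\<close>

definition bprod_integrand' :: "complex \<Rightarrow> complex \<Rightarrow> real \<Rightarrow> complex \<Rightarrow> real \<Rightarrow> complex" where
  "bprod_integrand' \<nu> \<sigma> \<theta> y u =
     2 * \<i> * sin (of_real u) * (bprod \<nu> y (of_real u) - bprod \<nu> y (- of_real u)) *
       bes \<sigma> (2 * y * of_real (cos u - cos \<theta>)) * of_real (cos u - cos \<theta>) powr \<sigma>
     - 2 * (bprod' \<nu> y (of_real u) + bprod' \<nu> y (- of_real u)) *
       bes (\<sigma> + 1) (2 * y * of_real (cos u - cos \<theta>)) * of_real (cos u - cos \<theta>) powr (\<sigma> + 1)"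

text \<open>The first term differentiates \<open>bprod'\<close>. The second differentiates
  \<open>bes \<sigma>\<close>, whose inner derivative 2 c raises the exponent of c from \<sigma> to
  \<sigma> + 1.\<close>

lemma bprod_integrand_deriv_y:
  assumes "\<bar>u\<bar> < \<theta>" "\<theta> < pi"
  shows "((\<lambda>y. bprod_integrand \<nu> \<sigma> \<theta> y u) has_field_derivative bprod_integrand' \<nu> \<sigma> \<theta> y u) (at y)"
proof -
  have p: "of_real (cos u - cos \<theta>) powr (\<sigma> + 1) = of_real (cos u - cos \<theta>) powr \<sigma> * complex_of_real (cos u - cos \<theta>)"
    using cos_diff_pos[OF assms] by (simp add: powr_add powr_nat')
  show ?thesis
    unfolding bprod_integrand_def bprod_integrand'_def p
    by (rule derivative_eq_intros bprod'_deriv_y refl)+ (simp add: algebra_simps)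
qed

text \<open>Differentiating the Bessel factor and the power together produces (\<sigma> + 1)
  \<open>bes (\<sigma> + 1)\<close> - 2 y c \<open>bes (\<sigma> + 2)\<close> at 2 y c, which the
  contiguous relation collapses to \<open>bes \<sigma>\<close>.\<close>

lemma bprod_primitive_deriv_u:
  assumes "\<bar>u\<bar> < \<theta>" "\<theta> < pi"
  shows "(bprod_primitive \<nu> \<sigma> \<theta> y has_vector_derivative bprod_integrand' \<nu> \<sigma> \<theta> y u) (at u within S)"
proof -
  define c where "c = complex_of_real (cos u - cos \<theta>)"
  have pos: "cos u - cos \<theta> > 0" by (rule cos_diff_pos) fact+
  have p: "c powr (\<sigma> + 1) = c powr \<sigma> * c"
    using pos by (simp add: powr_add powr_nat' c_def)
  have ct: "bes \<sigma> (2 * y * c) = (\<sigma> + 1) * bes (\<sigma> + 1) (2 * y * c) - 2 * y * c * bes (\<sigma> + 1 + 1) (2 * y * c)"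
    using bes_contiguous[of "\<sigma> + 1" "2 * y * c"] by simp
  have d1: "((\<lambda>u. - 2 * \<i> * (bprod \<nu> y (of_real u) - bprod \<nu> y (- of_real u))) has_vector_derivative
      - 2 * (bprod' \<nu> y (of_real u) + bprod' \<nu> y (- of_real u))) (at u within S)"
  proof (rule has_vector_derivative_real_field)
    have "((\<lambda>u. bprod \<nu> y (- u)) has_field_derivative \<i> * bprod' \<nu> y (- z)) (at z)" for z
      using DERIV_chain2[where f = "bprod \<nu> y" and g = uminus and Db = "- 1" and x = z and s = UNIV, OF bprod_deriv_u]
      by (simp add: DERIV_minus[OF DERIV_ident])
    from DERIV_cmult[OF DERIV_diff[OF bprod_deriv_u[of \<nu> y "of_real u"] this], of "- 2 * \<i>"]
    show "((\<lambda>u. - 2 * \<i> * (bprod \<nu> y u - bprod \<nu> y (- u))) has_field_derivative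
      - 2 * (bprod' \<nu> y (of_real u) + bprod' \<nu> y (- of_real u))) (at (of_real u))"
      by (simp add: algebra_simps)
  qed
  have d2: "((\<lambda>u. bes (\<sigma> + 1) (2 * y * of_real (cos u - cos \<theta>))) has_vector_derivative
      bes (\<sigma> + 1 + 1) (2 * y * c) * (2 * y * of_real (sin u))) (at u within S)"
  proof -
    have "((\<lambda>u. bes (\<sigma> + 1) (2 * y * (cos u - cos (of_real \<theta>)))) has_field_derivative
      bes (\<sigma> + 1 + 1) (2 * y * c) * (2 * y * of_real (sin u))) (at (of_real u))"
      by (rule derivative_eq_intros refl)+ (simp add: c_def sin_of_real cos_of_real)
    from has_vector_derivative_real_field[OF this] show ?thesis
      by (simp add: cos_of_real)
  qed
  have d3: "((\<lambda>u. of_real (cos u - cos \<theta>) powr (\<sigma> + 1)) has_vector_derivative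
      (\<sigma> + 1) * c powr (\<sigma> + 1 - 1) * of_real (- sin u)) (at u within S)"
    unfolding c_def by (rule has_vector_derivative_powr_of_real) (use pos in \<open>auto intro!: derivative_eq_intros\<close>)
  have "(bprod_primitive \<nu> \<sigma> \<theta> y has_vector_derivative
     - 2 * \<i> * (bprod \<nu> y (of_real u) - bprod \<nu> y (- of_real u)) * bes (\<sigma> + 1) (2 * y * c) *
       ((\<sigma> + 1) * c powr (\<sigma> + 1 - 1) * of_real (- sin u)) +
     (- 2 * \<i> * (bprod \<nu> y (of_real u) - bprod \<nu> y (- of_real u)) * (bes (\<sigma> + 1 + 1) (2 * y * c) * (2 * y * of_real (sin u))) +
     - 2 * (bprod' \<nu> y (of_real u) + bprod' \<nu> y (- of_real u)) * bes (\<sigma> + 1) (2 * y * c)) * c powr (\<sigma> + 1)) (at u within S)"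
    using has_vector_derivative_mult[OF has_vector_derivative_mult[OF d1 d2] d3]
    unfolding bprod_primitive_def [abs_def] c_def by simp
  moreover have "- 2 * \<i> * (bprod \<nu> y (of_real u) - bprod \<nu> y (- of_real u)) * bes (\<sigma> + 1) (2 * y * c) *
       ((\<sigma> + 1) * c powr (\<sigma> + 1 - 1) * of_real (- sin u)) +
     (- 2 * \<i> * (bprod \<nu> y (of_real u) - bprod \<nu> y (- of_real u)) * (bes (\<sigma> + 1 + 1) (2 * y * c) * (2 * y * of_real (sin u))) +
     - 2 * (bprod' \<nu> y (of_real u) + bprod' \<nu> y (- of_real u)) * bes (\<sigma> + 1) (2 * y * c)) * c powr (\<sigma> + 1) =
    bprod_integrand' \<nu> \<sigma> \<theta> y u"
    unfolding bprod_integrand'_def c_def[symmetric] ct p by (simp add: sin_of_real algebra_simps)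
  ultimately show ?thesis by simp
qed

text \<open>Stopping at \<eta> < \<theta> keeps c positive, so everything is continuous and
  differentiation under the integral is allowed. The fundamental theorem then leaves only the upper
  boundary term.\<close>

lemma integral_bprod_integrand_truncated:
  assumes "0 < \<eta>" "\<eta> < \<theta>" "\<theta> < pi"
  shows "((\<lambda>y. integral {0..\<eta>} (bprod_integrand \<nu> \<sigma> \<theta> y)) has_field_derivative
            bprod_primitive \<nu> \<sigma> \<theta> y \<eta>) (at y)"
proof -
  have pos: "cos u - cos \<theta> > 0" if "u \<in> {0..\<eta>}" for u
    by (rule cos_diff_pos) (use that assms in auto)
  have "((\<lambda>y. integral (cbox 0 \<eta>) (bprod_integrand \<nu> \<sigma> \<theta> y)) has_field_derivative
            integral (cbox 0 \<eta>) (bprod_integrand' \<nu> \<sigma> \<theta> y)) (at y within UNIV)"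
  proof (rule leibniz_rule_field_derivative)
    show "((\<lambda>x. bprod_integrand \<nu> \<sigma> \<theta> x t) has_field_derivative bprod_integrand' \<nu> \<sigma> \<theta> x t) (at x)"
      if "t \<in> cbox 0 \<eta>" for x t
      by (rule bprod_integrand_deriv_y) (use that assms in auto)
    show "bprod_integrand \<nu> \<sigma> \<theta> x integrable_on cbox 0 \<eta>" for x
      unfolding bprod_integrand_def [abs_def]
      by (intro integrable_continuous continuous_intros) (use pos in force)+
    show "continuous_on (UNIV \<times> cbox 0 \<eta>) (\<lambda>(x, t). bprod_integrand' \<nu> \<sigma> \<theta> x t)"
      unfolding bprod_integrand'_def split_beta
      by (intro continuous_intros) (use pos in force)+
  qed auto
  moreover have "(bprod_integrand' \<nu> \<sigma> \<theta> y has_integral bprod_primitive \<nu> \<sigma> \<theta> y \<eta> - bprod_primitive \<nu> \<sigma> \<theta> y 0) {0..\<eta>}"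
    by (intro fundamental_theorem_of_calculus bprod_primitive_deriv_u) (use assms in auto)
  moreover have "bprod_primitive \<nu> \<sigma> \<theta> y 0 = 0" by (simp add: bprod_primitive_def)
  ultimately show ?thesis by (simp add: integral_unique)
qed

lemma bprod_integrand_absolutely_integrable:
  assumes "(\<lambda>u. complex_of_real (cos u - cos \<theta>) powr \<sigma>) absolutely_integrable_on {0..\<theta>}"
  shows "bprod_integrand \<nu> \<sigma> \<theta> y absolutely_integrable_on {0..\<theta>}"
  unfolding bprod_integrand_def [abs_def]
  by (intro absolutely_integrable_continuous_times assms continuous_intros)

text \<open>The boundary term of the primitive at \<open>\<eta> \<rightarrow> \<theta>\<close> carries the factor
  \<open>(cos \<eta> - cos \<theta>)\<close> to the power \<open>\<sigma> + 1\<close>, which tends to 0.\<close>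

lemma integral_bprod_integrand_const:
  assumes "Re \<sigma> > - 1" "0 < \<theta>" "\<theta> < pi"
    and int: "(\<lambda>u. complex_of_real (cos u - cos \<theta>) powr \<sigma>) absolutely_integrable_on {0..\<theta>}"
  shows "integral {0..\<theta>} (bprod_integrand \<nu> \<sigma> \<theta> y) = integral {0..\<theta>} (bprod_integrand \<nu> \<sigma> \<theta> 0)"
proof -
  define D where "D \<eta> = integral {0..\<eta>} (bprod_integrand \<nu> \<sigma> \<theta> y) - integral {0..\<eta>} (bprod_integrand \<nu> \<sigma> \<theta> 0)" for \<eta>
  define P where "P = (\<lambda>(y, u). - 2 * \<i> * (bprod \<nu> y (of_real u) - bprod \<nu> y (- of_real u)) *
     bes (\<sigma> + 1) (2 * y * of_real (cos u - cos \<theta>)))"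
  have "compact (P ` (cball 0 (norm y) \<times> {0..\<theta>}))"
    unfolding P_def split_beta by (intro compact_continuous_image continuous_intros compact_Times) auto
  then obtain M where M: "\<And>z u. z \<in> cball 0 (norm y) \<Longrightarrow> u \<in> {0..\<theta>} \<Longrightarrow> norm (P (z, u)) \<le> M"
    by (fastforce dest!: compact_imp_bounded simp: bounded_iff)
  \<comment> \<open>Mean value inequality in y between 0 and y on a convex ball: the derivative is
    the boundary term, and M bounds its regular part uniformly in y and \<eta>.\<close>
  have bound: "norm (D \<eta>) \<le> M * norm (complex_of_real (cos \<eta> - cos \<theta>) powr (\<sigma> + 1)) * norm (y - 0)"
    if "0 < \<eta>" "\<eta> < \<theta>" for \<eta>
    unfolding D_def
  proof (rule field_differentiable_bound[where S = "cball 0 (norm y)"])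
    fix z :: complex assume z: "z \<in> cball 0 (norm y)"
    show "((\<lambda>y. integral {0..\<eta>} (bprod_integrand \<nu> \<sigma> \<theta> y)) has_field_derivative
            bprod_primitive \<nu> \<sigma> \<theta> z \<eta>) (at z within cball 0 (norm y))"
      using integral_bprod_integrand_truncated[OF that \<open>\<theta> < pi\<close>] by (rule has_field_derivative_at_within)
    have "bprod_primitive \<nu> \<sigma> \<theta> z \<eta> = P (z, \<eta>) * complex_of_real (cos \<eta> - cos \<theta>) powr (\<sigma> + 1)"
      by (simp add: bprod_primitive_def P_def)
    then show "norm (bprod_primitive \<nu> \<sigma> \<theta> z \<eta>) \<le> M * norm (complex_of_real (cos \<eta> - cos \<theta>) powr (\<sigma> + 1))"
      using M[OF z, of \<eta>] that by (simp add: norm_mult mult_right_mono)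
  qed auto
  \<comment> \<open>The offset 2 keeps even the first term strictly above 0.\<close>
  define \<eta> where "\<eta> n = \<theta> - \<theta> / real (n + 2)" for n
  have \<eta>: "0 < \<eta> n" "\<eta> n < \<theta>" for n
    using assms by (auto simp: \<eta>_def field_simps intro: add_pos_nonneg)
  have lim: "\<eta> \<longlonglongrightarrow> \<theta>"
    unfolding \<eta>_def by real_asymp
  have cont: "continuous_on {0..\<theta>} D"
    unfolding D_def [abs_def]
    by (intro continuous_intros indefinite_integral_continuous_1 set_lebesgue_integral_eq_integral(1)
          bprod_integrand_absolutely_integrable int)
  have "(\<lambda>n. D (\<eta> n)) \<longlonglongrightarrow> D \<theta>"
    by (rule continuous_on_tendsto_compose[OF cont lim]) (use \<eta> assms in \<open>auto intro!: always_eventually less_imp_le\<close>)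
  moreover have "(\<lambda>n. D (\<eta> n)) \<longlonglongrightarrow> 0"
  proof (rule Lim_null_comparison)
    show "\<forall>\<^sub>F n in sequentially. norm (D (\<eta> n)) \<le>
        M * norm (complex_of_real (cos (\<eta> n) - cos \<theta>) powr (\<sigma> + 1)) * norm (y - 0)"
      using bound \<eta> by (intro always_eventually) auto
    have "continuous_on {0..\<theta>} (\<lambda>u. complex_of_real (cos u - cos \<theta>) powr (\<sigma> + 1))"
      by (intro continuous_intros) (use assms in \<open>auto intro!: cos_monotone_0_pi_le\<close>)
    then have "(\<lambda>n. complex_of_real (cos (\<eta> n) - cos \<theta>) powr (\<sigma> + 1)) \<longlonglongrightarrow> complex_of_real (cos \<theta> - cos \<theta>) powr (\<sigma> + 1)"
      by (rule continuous_on_tendsto_compose[OF _ lim]) (use \<eta> assms in \<open>auto intro!: always_eventually less_imp_le\<close>)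
    then have "(\<lambda>n. M * norm (complex_of_real (cos (\<eta> n) - cos \<theta>) powr (\<sigma> + 1)) * norm (y - 0)) \<longlonglongrightarrow>
       M * norm (complex_of_real (cos \<theta> - cos \<theta>) powr (\<sigma> + 1)) * norm (y - 0)"
      by (intro tendsto_mult tendsto_norm tendsto_const)
    then show "(\<lambda>n. M * norm (complex_of_real (cos (\<eta> n) - cos \<theta>) powr (\<sigma> + 1)) * norm (y - 0)) \<longlonglongrightarrow> 0"
      by simp
  qed
  ultimately have "D \<theta> = 0" by (rule LIMSEQ_unique)
  then show ?thesis by (simp add: D_def)
qed

section \<open>Continuity of the Bessel functions in order and argument\<close>

lemma holomorphic_Bessel_J_order [holomorphic_intros]:
  assumes "f holomorphic_on A"
  shows "(\<lambda>s. Bessel_J (f s) l) holomorphic_on A"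
proof -
  have "(\<lambda>s. Bessel_J s l) holomorphic_on UNIV"
    unfolding Bessel_J_eq_bes by (intro holomorphic_intros holomorphic_bes_order)
  from holomorphic_on_compose_gen[OF assms this] show ?thesis by (simp add: o_def)
qed

lemma continuous_on_Bessel_J [continuous_intros]:
  assumes "continuous_on A f" "continuous_on A h"
  shows "continuous_on A (\<lambda>x. Bessel_J (f x) (h x))"
  unfolding Bessel_J_eq_bes by (intro continuous_intros assms) auto

text \<open>For order - m the power e^(-m) times (- e^2)^m equals (-1)^m e^m. Consequently the
  numerator in the quotient defining Y vanishes at integer orders.\<close>

lemma Bessel_J_minus_Ints:
  assumes "n \<in> \<int>"
  shows "Bessel_J (- n) l = Bessel_J n l * cos (of_real pi * n)"
proof -
  have nat: "Bessel_J (- of_nat m) l = (- 1) ^ m * Bessel_J (of_nat m) l" for m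
  proof -
    define e where "e = exp (l - of_real (ln 2))"
    have e: "exp l / 2 = e" by (simp add: e_def exp_diff exp_of_real)
    have "e \<noteq> 0" by (simp add: e_def)
    have p: "exp (of_nat m * (l - of_real (ln 2))) = e ^ m"
      by (simp add: e_def exp_of_nat_mult)
    have p': "exp (- of_nat m * (l - of_real (ln 2))) = inverse (e ^ m)"
      by (simp only: mult_minus_left exp_minus p)
    have "Bessel_J (- of_nat m) l = inverse (e ^ m) * ((- (e\<^sup>2)) ^ m * bes (of_nat m) (e\<^sup>2))"
      unfolding Bessel_J_eq_bes e p' bes_neg_nat ..
    also have "\<dots> = (- 1) ^ m * (e ^ m * bes (of_nat m) (e\<^sup>2))"
      using \<open>e \<noteq> 0\<close> by (subst power_minus) (simp add: power2_eq_square power_mult_distrib)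
    also have "e ^ m * bes (of_nat m) (e\<^sup>2) = Bessel_J (of_nat m) l"
      unfolding Bessel_J_eq_bes e p ..
    finally show ?thesis .
  qed
  have cos: "cos (complex_of_real pi * of_nat m) = (- 1) ^ m" for m
    using arg_cong[OF cos_npi[of m], of complex_of_real] by (simp add: cos_of_real mult.commute)
  from assms obtain k where k: "n = of_int k" by (auto elim: Ints_cases)
  show ?thesis
  proof (cases "k \<ge> 0")
    case True
    then have "n = of_nat (nat k)" by (simp add: k)
    then show ?thesis using nat[of "nat k"] cos[of "nat k"] by simp
  next
    case False
    then have n: "n = - of_nat (nat (- k))" by (simp add: k)
    have "(- 1) ^ nat (- k) * ((- 1) ^ nat (- k) * z) = z" for z :: complex
      by (simp flip: mult.assoc power_mult_distrib)
    then show ?thesis unfolding n using nat[of "nat (- k)"] cos[of "nat (- k)"] by (simp add: mult_ac)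
  qed
qed

lemma sin_pi_eq_0_iff: "sin (complex_of_real pi * s) = 0 \<longleftrightarrow> s \<in> \<int>"
proof
  assume "sin (complex_of_real pi * s) = 0"
  then obtain n :: int where "complex_of_real pi * s = of_real (real_of_int n * pi)"
    by (auto simp: sin_eq_0)
  then have "s = of_int n" by (simp add: mult.commute)
  then show "s \<in> \<int>" by simp
next
  assume "s \<in> \<int>"
  then obtain n where "s = of_int n" by (auto elim: Ints_cases)
  then show "sin (complex_of_real pi * s) = 0"
    by (auto simp: sin_eq_0 intro!: exI[of _ n])
qed

section \<open>The Bessel function of the second kind near integer orders\<close>

definition Y_quot :: "complex \<Rightarrow> complex \<Rightarrow> complex" where
  "Y_quot s l = (Bessel_J s l * cos (of_real pi * s) - Bessel_J (- s) l) / sin (of_real pi * s)"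

lemma Bessel_Y_not_Ints: "s \<notin> \<int> \<Longrightarrow> Bessel_Y s l = Y_quot s l"
  by (simp add: Bessel_Y_def Y_quot_def Let_def)

lemma Bessel_Y_Ints: "s \<in> \<int> \<Longrightarrow> Bessel_Y s l = Lim (at s) (\<lambda>s. Y_quot s l)"
  by (simp add: Bessel_Y_def Y_quot_def Let_def)

text \<open>Numerator and sine both vanish at n and are differentiable there, and the sine has the
  nonzero derivative \<pi> cos (\<pi> n); the quotient of the difference quotients therefore
  converges. This gives meaning to \<open>Lim\<close> in the definition of
  \<open>Bessel_Y\<close>.\<close>

lemma Y_quot_tendsto:
  assumes "n \<in> \<int>"
  shows "\<exists>L. ((\<lambda>s. Y_quot s l) \<longlongrightarrow> L) (at n)"
proof -
  define N where "N s = Bessel_J s l * cos (of_real pi * s) - Bessel_J (- s) l" for s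
  define D where "D s = sin (complex_of_real pi * s)" for s
  have "N holomorphic_on UNIV" unfolding N_def [abs_def] by (intro holomorphic_intros)
  then obtain N' where N': "(N has_field_derivative N') (at n)"
    by (auto simp: holomorphic_on_def field_differentiable_def)
  have D': "(D has_field_derivative cos (of_real pi * n) * of_real pi) (at n)"
    unfolding D_def [abs_def] by (auto intro!: derivative_eq_intros)
  have s0: "sin (complex_of_real pi * n) = 0" using assms by (simp add: sin_pi_eq_0_iff)
  then have "cos (complex_of_real pi * n) \<noteq> 0"
    by (metis sin_cos_squared_add power_zero_numeral add.left_neutral zero_neq_one)
  then have "((\<lambda>s. ((N s - N n) / (s - n)) / ((D s - D n) / (s - n))) \<longlongrightarrow> N' / (cos (of_real pi * n) * of_real pi)) (at n)"
    using N' D' by (intro tendsto_divide) (auto simp: has_field_derivative_iff)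
  moreover have "N n = 0" by (simp add: N_def Bessel_J_minus_Ints assms)
  moreover have "D n = 0" by (simp add: D_def s0)
  ultimately have "((\<lambda>s. (N s / (s - n)) / (D s / (s - n))) \<longlongrightarrow> N' / (cos (of_real pi * n) * of_real pi)) (at n)"
    by simp
  then have "((\<lambda>s. Y_quot s l) \<longlongrightarrow> N' / (cos (of_real pi * n) * of_real pi)) (at n)"
    by (rule Lim_transform_eventually)
       (auto simp: eventually_at_filter Y_quot_def N_def D_def)
  then show ?thesis ..
qed

lemma not_Ints_near:
  assumes "n \<in> \<int>" "dist n s < 1" "s \<noteq> n"
  shows "s \<notin> (\<int> :: complex set)"
proof
  assume "s \<in> \<int>"
  with assms obtain a b where "n = of_int a" "s = of_int b" by (auto elim!: Ints_cases)
  with assms have "norm (of_int (a - b) :: complex) < 1" "a \<noteq> b"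
    by (auto simp: dist_norm)
  then show False by (simp only: norm_of_int)
qed

text \<open>No other integer lies within distance 1 of n, so near n the function is the plain
  quotient, whose limit is by definition the value at n.\<close>

lemma Bessel_Y_tendsto: "((\<lambda>s. Bessel_Y s l) \<longlongrightarrow> Bessel_Y n l) (at n)" if n: "n \<in> \<int>"
proof -
  obtain L where L: "((\<lambda>s. Y_quot s l) \<longlongrightarrow> L) (at n)"
    using Y_quot_tendsto[OF n] by blast
  then have "Lim (at n) (\<lambda>s. Y_quot s l) = L"
    by (rule tendsto_Lim[rotated]) simp
  then have "Bessel_Y n l = L"
    using n by (simp only: Bessel_Y_Ints)
  moreover have "\<forall>\<^sub>F s in at n. Y_quot s l = Bessel_Y s l"
    unfolding eventually_at
  proof (intro exI conjI ballI impI)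
    fix s assume "s \<noteq> n \<and> dist s n < 1"
    then have "s \<notin> \<int>" using not_Ints_near[OF n, of s] by (simp add: dist_commute)
    then show "Y_quot s l = Bessel_Y s l" by (rule Bessel_Y_not_Ints[symmetric])
  qed simp
  ultimately show ?thesis using Lim_transform_eventually[OF L] by (simp only:)
qed

text \<open>Off the integers the quotient formula applies; at an integer the established continuity
  makes the singularity removable. The complement of the integers and the unit balls around them
  cover the plane.\<close>

lemma holomorphic_Bessel_Y_order: "(\<lambda>s. Bessel_Y s l) holomorphic_on UNIV"
proof -
  have Q: "(\<lambda>s. Bessel_Y s l) holomorphic_on (- \<int>)"
  proof (rule holomorphic_transform)
    show "(\<lambda>s. Y_quot s l) holomorphic_on (- \<int>)"
      unfolding Y_quot_def by (intro holomorphic_intros) (auto simp: sin_pi_eq_0_iff)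
  qed (auto simp: Bessel_Y_not_Ints)
  have "(\<lambda>s. Bessel_Y s l) holomorphic_on ball z 1" if "z \<in> \<int>" for z
  proof (rule no_isolated_singularity'[where K = "{z}"])
    show "((\<lambda>s. Bessel_Y s l) \<longlongrightarrow> Bessel_Y w l) (at w within ball z 1)" if "w \<in> {z}" for w
      using Bessel_Y_tendsto[of z l] that \<open>z \<in> \<int>\<close> by (auto intro: tendsto_within_subset)
    show "(\<lambda>s. Bessel_Y s l) holomorphic_on ball z 1 - {z}"
      by (rule holomorphic_on_subset[OF Q]) (use not_Ints_near[OF that] in auto)
  qed auto
  then have "(\<lambda>s. Bessel_Y s l) holomorphic_on (\<Union>z\<in>\<int>. ball z 1)"
    by (intro holomorphic_on_UN_open) auto
  with Q have "(\<lambda>s. Bessel_Y s l) holomorphic_on (- \<int> \<union> (\<Union>z\<in>\<int>. ball z 1))"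
    by (intro holomorphic_on_Un) (auto intro: closed_Ints)
  moreover have "- \<int> \<union> (\<Union>z\<in>\<int>. ball z 1) = (UNIV :: complex set)"
    by auto
  ultimately show ?thesis by simp
qed

text \<open>Joint continuity at an integer order follows from the maximum modulus principle in the order,
  which compares with the circle of radius 1/2, where the quotient formula applies.\<close>

lemma isCont_Bessel_Y: "isCont (\<lambda>(s, l). Bessel_Y s l) (s, l)"
proof (cases "s \<in> \<int>")
  case False
  have "continuous_on ((- \<int>) \<times> UNIV) (\<lambda>x. Y_quot (fst x) (snd x))"
    unfolding Y_quot_def by (intro continuous_intros) (auto simp: sin_pi_eq_0_iff)
  then have "continuous_on ((- \<int>) \<times> UNIV) (\<lambda>(s, l). Bessel_Y s l)"
    by (rule continuous_on_eq) (auto simp: Bessel_Y_not_Ints)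
  then show ?thesis
    by (rule continuous_on_interior) (use False in \<open>auto simp: interior_open open_Times open_Compl\<close>)
next
  case True
  have nI: "t \<notin> \<int>" if "dist s t = 1 / 2" for t
  proof -
    have "t \<noteq> s" using that by auto
    then show ?thesis using not_Ints_near[OF True, of t] that by simp
  qed
  \<comment> \<open>The circle contains no integer, so the sine in the denominator has no zero on
    this compact set.\<close>
  have uc: "uniformly_continuous_on (sphere s (1/2) \<times> cball l 1) (\<lambda>x. Y_quot (fst x) (snd x))"
    unfolding Y_quot_def
    by (intro compact_uniformly_continuous continuous_intros compact_Times)
       (use nI in \<open>auto simp: sin_pi_eq_0_iff\<close>)
  show ?thesis
    unfolding continuous_at_eps_delta
  proof (intro allI impI)
    fix e :: real assume "e > 0"
    then obtain d where d: "d > 0" "\<And>t m. t \<in> sphere s (1/2) \<Longrightarrow> m \<in> cball l 1 \<Longrightarrow> dist m l < d \<Longrightarrow>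
        dist (Y_quot t m) (Y_quot t l) < e / 2"
    proof -
      obtain d where d: "d > 0" "\<forall>x\<in>sphere s (1/2) \<times> cball l 1. \<forall>x'\<in>sphere s (1/2) \<times> cball l 1.
          dist x' x < d \<longrightarrow> dist (Y_quot (fst x') (snd x')) (Y_quot (fst x) (snd x)) < e / 2"
        using uc[unfolded uniformly_continuous_on_def, THEN spec, of "e / 2"] \<open>e > 0\<close> by auto
      have "dist (Y_quot t m) (Y_quot t l) < e / 2"
        if "t \<in> sphere s (1/2)" "m \<in> cball l 1" "dist m l < d" for t m
        using d(2)[rule_format, of "(t, l)" "(t, m)"] that by (simp add: dist_Pair_Pair)
      with d(1) show thesis by (rule that)
    qed
    have bound: "norm (Bessel_Y t m - Bessel_Y t l) \<le> e / 2"
      if "dist m l < min d 1" "t \<in> cball s (1/2)" for t m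
    proof (rule maximum_modulus_frontier[where f = "\<lambda>t. Bessel_Y t m - Bessel_Y t l" and S = "cball s (1/2)"])
      have h: "(\<lambda>t. Bessel_Y t m - Bessel_Y t l) holomorphic_on A" for A
        by (intro holomorphic_intros holomorphic_on_subset[OF holomorphic_Bessel_Y_order]) auto
      show "(\<lambda>t. Bessel_Y t m - Bessel_Y t l) holomorphic_on interior (cball s (1/2))" by (rule h)
      show "continuous_on (closure (cball s (1/2))) (\<lambda>t. Bessel_Y t m - Bessel_Y t l)"
        by (intro holomorphic_on_imp_continuous_on h)
      show "norm (Bessel_Y z m - Bessel_Y z l) \<le> e / 2" if "z \<in> frontier (cball s (1/2))" for z
      proof -
        have "z \<in> sphere s (1/2)" using that by simp
        then show ?thesis
          using d(2)[of z m] nI[of z] \<open>dist m l < min d 1\<close>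
          by (simp add: Bessel_Y_not_Ints dist_norm norm_minus_commute)
      qed
    qed (use that in auto)
    have "isCont (\<lambda>s. Bessel_Y s l) s"
      using Bessel_Y_tendsto[OF True] by (simp add: isCont_def)
    then obtain d' where d': "d' > 0" "\<And>t. dist t s < d' \<Longrightarrow> dist (Bessel_Y t l) (Bessel_Y s l) < e / 2"
      using \<open>e > 0\<close> by (auto simp: continuous_at_eps_delta dest!: spec[of _ "e / 2"])
    show "\<exists>d>0. \<forall>x'. dist x' (s, l) < d \<longrightarrow>
        dist (case x' of (s, l) \<Rightarrow> Bessel_Y s l) (case (s, l) of (s, l) \<Rightarrow> Bessel_Y s l) < e"
    proof (intro exI conjI allI impI)
      show "min (min d 1) (min d' (1 / 2)) > 0" using d d' by simp
      fix x' assume x: "dist x' (s, l) < min (min d 1) (min d' (1 / 2))"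
      obtain t m where tm: "x' = (t, m)" by (cases x')
      have "dist t s \<le> dist x' (s, l)" "dist m l \<le> dist x' (s, l)"
        using dist_fst_le[of x' "(s, l)"] dist_snd_le[of x' "(s, l)"] by (simp_all add: tm)
      with x have le: "dist t s < d'" "dist t s < 1 / 2" "dist m l < min d 1" by auto
      have "dist (Bessel_Y t m) (Bessel_Y t l) \<le> e / 2"
        using bound[OF le(3), of t] le(2) by (simp add: dist_norm norm_minus_commute)
      moreover have "dist (Bessel_Y t l) (Bessel_Y s l) < e / 2" by (rule d'(2)[OF le(1)])
      ultimately show "dist (case x' of (s, l) \<Rightarrow> Bessel_Y s l) (case (s, l) of (s, l) \<Rightarrow> Bessel_Y s l) < e"
        using dist_triangle[of "Bessel_Y t m" "Bessel_Y s l" "Bessel_Y t l"] by (simp add: tm)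
    qed
  qed
qed

lemma continuous_on_Bessel_Y [continuous_intros]:
  assumes "continuous_on A f" "continuous_on A h"
  shows "continuous_on A (\<lambda>x. Bessel_Y (f x) (h x))"
proof -
  have "continuous_on UNIV (\<lambda>(s, l). Bessel_Y s l)"
    using isCont_Bessel_Y by (auto intro!: continuous_at_imp_continuous_on)
  from continuous_on_compose2[OF this continuous_on_Pair[OF assms]] show ?thesis by simp
qed

lemma continuous_on_Bessel_chi [continuous_intros]:
  assumes "continuous_on A f" "continuous_on A g" "continuous_on A h" "continuous_on A u"
  shows "continuous_on A (\<lambda>x. Bessel_chi (f x) (g x) (h x) (u x))"
  unfolding Bessel_chi_def
  by (intro continuous_on_diff continuous_on_mult continuous_on_add continuous_on_divide continuous_on_const
        continuous_on_of_real continuous_on_Bessel_J continuous_on_Bessel_Y assms) simp_all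

section \<open>Expansion of \<open>cos (\<nu> u)\<close> in powers of \<open>sin\<^sup>2 (u/2)\<close>\<close>

text \<open>Coefficients of the Gauss series \<open>F(1/2 - \<nu>, 1/2 + \<nu>; 1/2; w)\<close>.\<close>

definition hyp_half_coeff :: "complex \<Rightarrow> nat \<Rightarrow> complex" where
  "hyp_half_coeff \<nu> k = pochhammer (1/2 - \<nu>) k * pochhammer (1/2 + \<nu>) k / (pochhammer (1/2) k * fact k)"

text \<open>The hypergeometric ratio of consecutive coefficients, cleared of denominators; both the
  ratio test and the differential equation rest on it.\<close>

lemma hyp_half_coeff_Suc:
  "of_nat (Suc k) * (of_nat k + 1/2) * hyp_half_coeff \<nu> (Suc k) = ((of_nat k + 1/2)\<^sup>2 - \<nu>\<^sup>2) * hyp_half_coeff \<nu> k"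
proof -
  have nz: "pochhammer (1/2 :: complex) n \<noteq> 0" for n
  proof
    assume "pochhammer (1/2 :: complex) n = 0"
    then obtain k where "(1/2 :: complex) = - of_nat k" by (auto simp: pochhammer_eq_0_iff)
    then have "Re (1/2) = Re (- of_nat k)" by (rule arg_cong)
    then show False by simp
  qed
  have "pochhammer (1/2 :: complex) (Suc k) = pochhammer (1/2) k * (1/2 + of_nat k)"
    by (rule pochhammer_Suc)
  then have nz': "1/2 + of_nat k \<noteq> (0 :: complex)" using nz[of "Suc k"] by auto
  have "of_nat (Suc k) * (of_nat k + 1/2) * hyp_half_coeff \<nu> (Suc k) =
     (of_nat (Suc k) * (1/2 + of_nat k)) * ((pochhammer (1/2 - \<nu>) k * (1/2 - \<nu> + of_nat k)) * (pochhammer (1/2 + \<nu>) k * (1/2 + \<nu> + of_nat k)))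
     / ((pochhammer (1/2) k * (1/2 + of_nat k)) * (of_nat (Suc k) * fact k))"
    by (simp add: hyp_half_coeff_def pochhammer_Suc add.commute)
  also have "\<dots> = ((1/2 - \<nu> + of_nat k) * (1/2 + \<nu> + of_nat k)) * hyp_half_coeff \<nu> k"
    using nz' nz[of k] of_nat_neq_0[of k, where 'a = complex] unfolding hyp_half_coeff_def
    by (simp only: times_divide_eq_right times_divide_eq_left divide_eq_eq eq_divide_eq mult_eq_0_iff fact_nonzero de_Morgan_disj if_False) simp
  also have "(1/2 - \<nu> + of_nat k) * (1/2 + \<nu> + of_nat k) = (of_nat k + 1/2)\<^sup>2 - \<nu>\<^sup>2"
    by (simp add: power2_eq_square algebra_simps)
  finally show ?thesis .
qed

text \<open>Ratio test: the bound on the ratio of consecutive terms tends to |w|, so it eventually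
  falls below the midpoint r of |w| and 1.\<close>

lemma summable_hyp_half_coeff:
  assumes "norm w < 1"
  shows "summable (\<lambda>k. hyp_half_coeff \<nu> k * w ^ k)"
proof -
  define r where "r = (norm w + 1) / 2"
  define N where "N = (norm \<nu>)\<^sup>2"
  have r: "norm w < r" "r < 1" using assms by (auto simp: r_def)
  have "(\<lambda>k. ((real k + 1/2)\<^sup>2 + N) / (real (Suc k) * (real k + 1/2)) * norm w) \<longlonglongrightarrow> 1 * norm w"
    by (intro tendsto_mult tendsto_const) real_asymp
  then have "\<forall>\<^sub>F k in sequentially. ((real k + 1/2)\<^sup>2 + N) / (real (Suc k) * (real k + 1/2)) * norm w < r"
    using r by (intro order_tendstoD(2)) auto
  then obtain K where K: "\<And>k. k \<ge> K \<Longrightarrow> ((real k + 1/2)\<^sup>2 + N) / (real (Suc k) * (real k + 1/2)) * norm w < r"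
    by (auto simp: eventually_sequentially)
  show ?thesis
  proof (rule summable_ratio_test[OF r(2)])
    fix k assume "K \<le> k"
    have pos: "real (Suc k) * (real k + 1/2) > 0" by simp
    have nk: "norm (of_nat k + 1/2 :: complex) = real k + 1/2"
    proof -
      have "of_nat k + 1/2 = complex_of_real (real k + 1/2)" by simp
      then show ?thesis by (simp only: norm_of_real)
    qed
    have "real (Suc k) * (real k + 1/2) * norm (hyp_half_coeff \<nu> (Suc k)) = norm (of_nat (Suc k) * (of_nat k + 1/2) * hyp_half_coeff \<nu> (Suc k))"
      unfolding norm_mult nk norm_of_nat ..
    also have "\<dots> = norm ((of_nat k + 1/2)\<^sup>2 - \<nu>\<^sup>2) * norm (hyp_half_coeff \<nu> k)"
      unfolding hyp_half_coeff_Suc norm_mult ..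
    also have "\<dots> \<le> ((real k + 1/2)\<^sup>2 + N) * norm (hyp_half_coeff \<nu> k)"
      using norm_triangle_ineq4[of "(of_nat k + 1/2)\<^sup>2" "\<nu>\<^sup>2"] unfolding norm_power nk
      by (intro mult_right_mono) (auto simp: N_def norm_power)
    finally have "norm (hyp_half_coeff \<nu> (Suc k)) \<le> ((real k + 1/2)\<^sup>2 + N) / (real (Suc k) * (real k + 1/2)) * norm (hyp_half_coeff \<nu> k)"
      unfolding times_divide_eq_left pos_le_divide_eq[OF pos] by (simp only: mult_ac)
    then have "norm (hyp_half_coeff \<nu> (Suc k)) * norm w \<le> ((real k + 1/2)\<^sup>2 + N) / (real (Suc k) * (real k + 1/2)) * norm (hyp_half_coeff \<nu> k) * norm w"
      by (rule mult_right_mono) simp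
    also have "\<dots> = (((real k + 1/2)\<^sup>2 + N) / (real (Suc k) * (real k + 1/2)) * norm w) * norm (hyp_half_coeff \<nu> k)"
      by (simp only: mult_ac)
    also have "\<dots> \<le> r * norm (hyp_half_coeff \<nu> k)"
      using K[OF \<open>K \<le> k\<close>] by (intro mult_right_mono) auto
    finally have "norm (hyp_half_coeff \<nu> (Suc k)) * norm w * norm (w ^ k) \<le> r * norm (hyp_half_coeff \<nu> k) * norm (w ^ k)"
      by (rule mult_right_mono) simp
    then show "norm (hyp_half_coeff \<nu> (Suc k) * w ^ Suc k) \<le> r * norm (hyp_half_coeff \<nu> k * w ^ k)"
      by (simp add: norm_mult mult_ac)
  qed
qed

section \<open>The hypergeometric differential equation\<close>

text \<open>The operator w d/dw multiplies the k-th coefficient by k; the index shift is free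
  because the term k = 0 vanishes.\<close>

lemma sums_of_nat_mult_diffs:
  fixes w :: complex
  assumes "summable (\<lambda>k. diffs c k * w ^ k)"
  shows "(\<lambda>k. of_nat k * c k * w ^ k) sums (w * (\<Sum>k. diffs c k * w ^ k))"
proof -
  have "(\<lambda>k. w * (diffs c k * w ^ k)) sums (w * (\<Sum>k. diffs c k * w ^ k))"
    using assms by (intro sums_mult summable_sums)
  then have "(\<lambda>k. of_nat (Suc k) * c (Suc k) * w ^ Suc k) sums (w * (\<Sum>k. diffs c k * w ^ k))"
    by (simp add: diffs_def mult_ac)
  then show ?thesis by (subst (asm) sums_Suc_iff) simp
qed

definition hyp_half :: "complex \<Rightarrow> complex \<Rightarrow> complex" where
  "hyp_half \<nu> w = (\<Sum>k. hyp_half_coeff \<nu> k * w ^ k)"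
definition hyp_half' :: "complex \<Rightarrow> complex \<Rightarrow> complex" where
  "hyp_half' \<nu> w = (\<Sum>k. diffs (hyp_half_coeff \<nu>) k * w ^ k)"
definition hyp_half'' :: "complex \<Rightarrow> complex \<Rightarrow> complex" where
  "hyp_half'' \<nu> w = (\<Sum>k. diffs (diffs (hyp_half_coeff \<nu>)) k * w ^ k)"

lemma summable_diffs_hyp_half_coeff:
  assumes "norm w < 1"
  shows "summable (\<lambda>k. diffs (hyp_half_coeff \<nu>) k * w ^ k)"
  using assms by (rule termdiff_converges) (rule summable_hyp_half_coeff)

lemma hyp_half_deriv:
  assumes "norm w < 1"
  shows "(hyp_half \<nu> has_field_derivative hyp_half' \<nu> w) (at w)"
    and "(hyp_half' \<nu> has_field_derivative hyp_half'' \<nu> w) (at w)"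
  unfolding hyp_half_def [abs_def] hyp_half'_def [abs_def] hyp_half''_def
  using assms by (auto intro!: termdiffs_strong'[of 1] summable_hyp_half_coeff summable_diffs_hyp_half_coeff)

text \<open>Gauss's equation with a = 1/2 - \<nu>, b = 1/2 + \<nu>, c = 1/2, hence a + b + 1 = 2 and
  ab = 1/4 - \<nu>^2. The coefficient of each power of w vanishes by the coefficient
  recurrence.\<close>

lemma hyp_half_ODE:
  assumes w: "norm w < 1"
  shows "w * (1 - w) * hyp_half'' \<nu> w + (1/2 - 2 * w) * hyp_half' \<nu> w - (1/4 - \<nu>\<^sup>2) * hyp_half \<nu> w = 0"
proof -
  let ?c = "hyp_half_coeff \<nu>"
  have s: "(\<lambda>k. ?c k * w ^ k) sums hyp_half \<nu> w"
    unfolding hyp_half_def by (intro summable_sums summable_hyp_half_coeff w)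
  have s': "(\<lambda>k. diffs ?c k * w ^ k) sums hyp_half' \<nu> w"
    unfolding hyp_half'_def by (intro summable_sums summable_diffs_hyp_half_coeff w)
  have ws': "(\<lambda>k. of_nat k * ?c k * w ^ k) sums (w * hyp_half' \<nu> w)"
    unfolding hyp_half'_def by (intro sums_of_nat_mult_diffs summable_diffs_hyp_half_coeff w)
  have ws'': "(\<lambda>k. of_nat k * diffs ?c k * w ^ k) sums (w * hyp_half'' \<nu> w)"
    unfolding hyp_half''_def using w
    by (intro sums_of_nat_mult_diffs termdiff_converges[of w 1] summable_diffs_hyp_half_coeff)
  have "(\<lambda>k. w * (of_nat k * diffs ?c k * w ^ k)) sums (w * (w * hyp_half'' \<nu> w))"
    by (rule sums_mult[OF ws''])
  then have "(\<lambda>k. (of_nat (Suc k) - 1) * of_nat (Suc k) * ?c (Suc k) * w ^ Suc k) sums (w * (w * hyp_half'' \<nu> w))"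
    by (simp add: diffs_def mult_ac)
  then have wws'': "(\<lambda>k. (of_nat k - 1) * of_nat k * ?c k * w ^ k) sums (w * (w * hyp_half'' \<nu> w))"
    by (subst (asm) sums_Suc_iff) simp
  have "(\<lambda>k. of_nat k * diffs ?c k * w ^ k - (of_nat k - 1) * of_nat k * ?c k * w ^ k
          + 1/2 * (diffs ?c k * w ^ k) - 2 * (of_nat k * ?c k * w ^ k) - (1/4 - \<nu>\<^sup>2) * (?c k * w ^ k)) sums
        (w * hyp_half'' \<nu> w - w * (w * hyp_half'' \<nu> w) + 1/2 * hyp_half' \<nu> w - 2 * (w * hyp_half' \<nu> w) - (1/4 - \<nu>\<^sup>2) * hyp_half \<nu> w)"
    by (intro sums_add sums_diff sums_mult s s' ws' ws'' wws'')
  moreover have "of_nat k * diffs ?c k * w ^ k - (of_nat k - 1) * of_nat k * ?c k * w ^ k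
          + 1/2 * (diffs ?c k * w ^ k) - 2 * (of_nat k * ?c k * w ^ k) - (1/4 - \<nu>\<^sup>2) * (?c k * w ^ k) = 0" for k
  proof -
    have "of_nat k * diffs ?c k * w ^ k - (of_nat k - 1) * of_nat k * ?c k * w ^ k
          + 1/2 * (diffs ?c k * w ^ k) - 2 * (of_nat k * ?c k * w ^ k) - (1/4 - \<nu>\<^sup>2) * (?c k * w ^ k)
        = (of_nat (Suc k) * (of_nat k + 1/2) * ?c (Suc k) - ((of_nat k + 1/2)\<^sup>2 - \<nu>\<^sup>2) * ?c k) * w ^ k"
      by (simp add: diffs_def power2_eq_square field_simps)
    then show ?thesis unfolding hyp_half_coeff_Suc by simp
  qed
  ultimately have "(\<lambda>k. 0) sums (w * hyp_half'' \<nu> w - w * (w * hyp_half'' \<nu> w) + 1/2 * hyp_half' \<nu> w - 2 * (w * hyp_half' \<nu> w) - (1/4 - \<nu>\<^sup>2) * hyp_half \<nu> w)"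
    by simp
  then have "w * hyp_half'' \<nu> w - w * (w * hyp_half'' \<nu> w) + 1/2 * hyp_half' \<nu> w - 2 * (w * hyp_half' \<nu> w) - (1/4 - \<nu>\<^sup>2) * hyp_half \<nu> w = 0"
    using sums_zero sums_unique2 by blast
  then show ?thesis by (simp add: algebra_simps)
qed

text \<open>Both sides solve \<open>y'' = - \<nu>\<^sup>2 y\<close> with \<open>y 0 = 1\<close>, \<open>y' 0 = 0\<close>.\<close>

lemma cos_eq_hyp_half:
  fixes u :: real
  assumes u: "\<bar>u\<bar> < pi"
  shows "cos (\<nu> * of_real u) = cos (of_real u / 2) * hyp_half \<nu> ((sin (of_real u / 2))\<^sup>2)"
proof -
  define y where "y u = cos (u / 2) * hyp_half \<nu> ((sin (u / 2))\<^sup>2)" for u :: complex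
  define y' where "y' u = - sin (u / 2) / 2 * hyp_half \<nu> ((sin (u / 2))\<^sup>2)
     + sin (u / 2) * (cos (u / 2))\<^sup>2 * hyp_half' \<nu> ((sin (u / 2))\<^sup>2)" for u :: complex
  have lt: "norm ((sin (complex_of_real t / 2))\<^sup>2) < 1" if "\<bar>t\<bar> < pi" for t
  proof -
    have "cos (t / 2) > 0" using that by (intro cos_gt_zero_pi) auto
    then have "(cos (t / 2))\<^sup>2 > 0" by simp
    then have "(sin (t / 2))\<^sup>2 < 1" using sin_cos_squared_add[of "t / 2"] by linarith
    moreover have "(sin (complex_of_real t / 2))\<^sup>2 = of_real ((sin (t / 2))\<^sup>2)"
      using sin_of_real[of "t / 2", where 'a = complex] by simp
    ultimately show ?thesis by (simp only: norm_of_real) simp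
  qed
  have dy: "(y has_field_derivative y' t) (at t)" if "norm ((sin (t / 2))\<^sup>2) < 1" for t
    unfolding y_def [abs_def] y'_def
    by (rule derivative_eq_intros DERIV_chain2[where f = "hyp_half \<nu>" and g = "\<lambda>u. (sin (u / 2))\<^sup>2" and x = t, OF hyp_half_deriv(1)[OF that]] refl | simp)+
       (simp add: power2_eq_square field_simps)
  \<comment> \<open>The substitution w = sin^2 (t/2) turns the hypergeometric equation into y'' = -
    \<nu>^2 y.\<close>
  have dy': "(y' has_field_derivative - \<nu>\<^sup>2 * y t) (at t)" if n: "norm ((sin (t / 2))\<^sup>2) < 1" for t
  proof -
    define S C where "S = sin (t / 2)" and "C = cos (t / 2)"
    have SC: "C\<^sup>2 = 1 - S\<^sup>2" by (simp add: S_def C_def cos_squared_eq)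
    have "(y' has_field_derivative
       (- (C / 4) * hyp_half \<nu> (S\<^sup>2) - S / 2 * (hyp_half' \<nu> (S\<^sup>2) * (S * C)))
       + ((C / 2 * C\<^sup>2 - S * (C * S)) * hyp_half' \<nu> (S\<^sup>2) + S * C\<^sup>2 * (hyp_half'' \<nu> (S\<^sup>2) * (S * C)))) (at t)"
      unfolding y'_def [abs_def] S_def C_def
      by (rule derivative_eq_intros DERIV_chain2[where f = "hyp_half \<nu>" and g = "\<lambda>u. (sin (u / 2))\<^sup>2" and x = t, OF hyp_half_deriv(1)[OF n]]
              DERIV_chain2[where f = "hyp_half' \<nu>" and g = "\<lambda>u. (sin (u / 2))\<^sup>2" and x = t, OF hyp_half_deriv(2)[OF n]] refl | simp)+
         (simp add: power2_eq_square field_simps)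
    moreover have "(- (C / 4) * hyp_half \<nu> (S\<^sup>2) - S / 2 * (hyp_half' \<nu> (S\<^sup>2) * (S * C)))
       + ((C / 2 * C\<^sup>2 - S * (C * S)) * hyp_half' \<nu> (S\<^sup>2) + S * C\<^sup>2 * (hyp_half'' \<nu> (S\<^sup>2) * (S * C)))
       = C * (S\<^sup>2 * (1 - S\<^sup>2) * hyp_half'' \<nu> (S\<^sup>2) + (1/2 - 2 * S\<^sup>2) * hyp_half' \<nu> (S\<^sup>2) - (1/4 - \<nu>\<^sup>2) * hyp_half \<nu> (S\<^sup>2)) - \<nu>\<^sup>2 * y t"
      unfolding SC y_def S_def[symmetric] C_def[symmetric] by (simp add: power2_eq_square field_simps)
    ultimately show ?thesis
      using hyp_half_ODE[of "S\<^sup>2" \<nu>] n by (simp add: S_def)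
  qed
  have y0: "y 0 = 1" "y' 0 = 0"
    using powser_zero[of "hyp_half_coeff \<nu>"] by (simp_all add: y_def y'_def hyp_half_def hyp_half_coeff_def)
  have const: "f (of_real u) = f 0"
    if "\<And>t. \<bar>t\<bar> < pi \<Longrightarrow> (f has_field_derivative 0) (at (complex_of_real t))" for f :: "complex \<Rightarrow> complex"
  proof -
    have "(\<lambda>t. f (of_real t)) u = f (of_real 0)"
    proof (rule has_derivative_zero_unique[where s = "{- pi<..<pi}" and f = "\<lambda>t. f (of_real t)" and x = 0 and y = u, symmetric])
      fix t assume "t \<in> {- pi<..<pi}"
      then have "((\<lambda>t. f (of_real t)) has_vector_derivative 0) (at t within {- pi<..<pi})"
        by (intro has_vector_derivative_real_field that) auto
      then show "((\<lambda>t. f (of_real t)) has_derivative (\<lambda>h. 0)) (at t within {- pi<..<pi})"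
        by (simp add: has_vector_derivative_def)
    qed (use u in auto)
    then show ?thesis by simp
  qed
  \<comment> \<open>For s = 1 and s = -1 this gives two first integrals: the derivative of (y' - s i
    \<nu> y) exp (s i \<nu> t) has the factor s^2 - 1. The value on the right is the one at t =
    0.\<close>
  have e: "(y' (of_real u) - s * \<i> * \<nu> * y (of_real u)) * exp (s * \<i> * \<nu> * of_real u) = - s * \<i> * \<nu>" if "s\<^sup>2 = 1" for s
  proof -
    have "((\<lambda>t. (y' t - s * \<i> * \<nu> * y t) * exp (s * \<i> * \<nu> * t)) has_field_derivative 0) (at (of_real t))" if "\<bar>t\<bar> < pi" for t
    proof -
      have "((\<lambda>t. (y' t - s * \<i> * \<nu> * y t) * exp (s * \<i> * \<nu> * t)) has_field_derivative
         (- \<nu>\<^sup>2 * y (of_real t) - s * \<i> * \<nu> * y' (of_real t)) * exp (s * \<i> * \<nu> * of_real t) +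
          (y' (of_real t) - s * \<i> * \<nu> * y (of_real t)) * (exp (s * \<i> * \<nu> * of_real t) * (s * \<i> * \<nu>))) (at (of_real t))"
        by (rule derivative_eq_intros dy dy' lt that refl | simp)+ 
      moreover have "(- \<nu>\<^sup>2 * y (of_real t) - s * \<i> * \<nu> * y' (of_real t)) * exp (s * \<i> * \<nu> * of_real t) +
          (y' (of_real t) - s * \<i> * \<nu> * y (of_real t)) * (exp (s * \<i> * \<nu> * of_real t) * (s * \<i> * \<nu>))
         = (s\<^sup>2 - 1) * (\<nu>\<^sup>2 * y (of_real t) * exp (s * \<i> * \<nu> * of_real t))"
        by (simp add: power2_eq_square algebra_simps)
      ultimately show ?thesis using \<open>s\<^sup>2 = 1\<close> by simp
    qed
    from const[OF this] show ?thesis by (simp add: y0)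
  qed
  have yu: "y (of_real u) = cos (\<nu> * of_real u)"
  \<comment> \<open>For \<nu> = 0 the two first integrals coincide and do not determine y; then y''
    = 0 is integrated twice directly.\<close>
  proof (cases "\<nu> = 0")
    case True
    have y'0: "y' (of_real t) = 0" if "\<bar>t\<bar> < pi" for t
    proof -
      have "y' (of_real t) = y' 0"
      proof -
        have "(\<lambda>t. y' (of_real t)) t = y' (of_real 0)"
        proof (rule has_derivative_zero_unique[where s = "{- pi<..<pi}" and f = "\<lambda>t. y' (of_real t)" and x = 0 and y = t, symmetric])
          fix t assume "t \<in> {- pi<..<pi}"
          then have "((\<lambda>t. y' (of_real t)) has_vector_derivative 0) (at t within {- pi<..<pi})"
            using dy'[OF lt, of t] True by (intro has_vector_derivative_real_field) auto
          then show "((\<lambda>t. y' (of_real t)) has_derivative (\<lambda>h. 0)) (at t within {- pi<..<pi})"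
            by (simp add: has_vector_derivative_def)
        qed (use that in auto)
        then show ?thesis by simp
      qed
      then show ?thesis by (simp add: y0)
    qed
    have "y (of_real u) = y 0"
    proof (rule const)
      fix t assume "\<bar>t\<bar> < pi"
      then show "(y has_field_derivative 0) (at (complex_of_real t))"
        using dy[OF lt, of t] y'0[of t] by simp
    qed
    then show ?thesis by (simp add: y0 True)
  next
    case False
    define E where "E = exp (\<i> * \<nu> * of_real u)"
    have E: "E \<noteq> 0" by (simp add: E_def)
    have 1: "(y' (of_real u) - \<i> * \<nu> * y (of_real u)) * E = - \<i> * \<nu>"
      using e[of 1] by (simp add: E_def)
    have 2: "(y' (of_real u) + \<i> * \<nu> * y (of_real u)) * inverse E = \<i> * \<nu>"
      using e[of "- 1"] by (simp add: E_def exp_minus)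
    have "y' (of_real u) - \<i> * \<nu> * y (of_real u) = - \<i> * \<nu> * inverse E"
      using 1 E by (simp add: field_simps)
    moreover have "y' (of_real u) + \<i> * \<nu> * y (of_real u) = \<i> * \<nu> * E"
      using 2 E by (simp add: field_simps)
    moreover have "2 * (\<i> * \<nu>) * y (of_real u) =
        (y' (of_real u) + \<i> * \<nu> * y (of_real u)) - (y' (of_real u) - \<i> * \<nu> * y (of_real u))"
      by (simp add: algebra_simps)
    ultimately have "2 * (\<i> * \<nu>) * y (of_real u) = (\<i> * \<nu>) * (E + inverse E)"
      by (simp only:) (simp add: algebra_simps)
    then have "2 * y (of_real u) = E + inverse E"
      using False by simp
    then show ?thesis
      by (simp add: cos_exp_eq E_def exp_minus mult_ac)
  qed
  then show ?thesis by (simp add: y_def)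
qed

section \<open>The Mehler--Dirichlet integral\<close>

lemma of_real_powr_eq_exp:
  assumes "0 < p"
  shows "complex_of_real p powr z = exp (z * of_real (ln p))"
  using assms by (simp add: powr_def Ln_of_real)

lemma cos_diff_eq_sin_half_squares: "cos u - cos \<theta> = 2 * ((sin (\<theta> / 2))\<^sup>2 - (sin (u / 2))\<^sup>2)" for u \<theta> :: real
  using cos_double_sin[of "u / 2"] cos_double_sin[of "\<theta> / 2"] by simp

text \<open>Supplies the bijection for the change of variables below; the preimage of w is 2 arcsin
  (sqrt w sin (\<theta>/2)).\<close>

lemma sin_half_square_image:
  assumes "0 < \<theta>" "\<theta> < pi"
  shows "(\<lambda>u. (sin (u / 2))\<^sup>2 / (sin (\<theta> / 2))\<^sup>2) ` {0<..<\<theta>} = {0<..<1}"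
    and "inj_on (\<lambda>u. (sin (u / 2))\<^sup>2 / (sin (\<theta> / 2))\<^sup>2) {0<..<\<theta>}"
proof -
  define T where "T = sin (\<theta> / 2)"
  have T: "T > 0" using assms by (auto simp: T_def intro: sin_gt_zero)
  have s: "0 < sin (u / 2)" "sin (u / 2) < T" if "u \<in> {0<..<\<theta>}" for u
    using that assms by (auto simp: T_def intro!: sin_gt_zero sin_monotone_2pi)
  have "w \<in> (\<lambda>u. (sin (u / 2))\<^sup>2 / T\<^sup>2) ` {0<..<\<theta>}" if w: "0 < w" "w < 1" for w
  proof (rule image_eqI)
    define x where "x = sqrt w * T"
    have x: "0 < x" "x < T" using w T by (auto simp: x_def)
    have "T \<le> 1" by (simp add: T_def)
    have "arcsin x < arcsin T" "arcsin 0 < arcsin x"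
      using x \<open>T \<le> 1\<close> by (auto intro: arcsin_less_arcsin simp del: arcsin_0)
    moreover have "arcsin T = \<theta> / 2" using assms by (simp add: T_def arcsin_sin)
    ultimately show "2 * arcsin x \<in> {0<..<\<theta>}" by simp
    show "w = (sin (2 * arcsin x / 2))\<^sup>2 / T\<^sup>2"
    proof -
      have "sin (arcsin x) = x" using x \<open>T \<le> 1\<close> by (intro sin_arcsin) auto
      then show ?thesis using T w by (simp add: x_def power_mult_distrib)
    qed
  qed
  moreover have "(sin (u / 2))\<^sup>2 / T\<^sup>2 \<in> {0<..<1}" if "u \<in> {0<..<\<theta>}" for u
    using s[OF that] T by (simp add: power_strict_mono)
  ultimately show "(\<lambda>u. (sin (u / 2))\<^sup>2 / (sin (\<theta> / 2))\<^sup>2) ` {0<..<\<theta>} = {0<..<1}"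
    unfolding T_def[symmetric] by auto
  show "inj_on (\<lambda>u. (sin (u / 2))\<^sup>2 / (sin (\<theta> / 2))\<^sup>2) {0<..<\<theta>}"
  proof (rule linorder_inj_onI)
    fix x y assume xy: "x < y" "x \<in> {0<..<\<theta>}" "y \<in> {0<..<\<theta>}"
    then have "sin (x / 2) < sin (y / 2)" using assms by (intro sin_monotone_2pi) auto
    then have "(sin (x / 2))\<^sup>2 < (sin (y / 2))\<^sup>2" using s(1)[OF xy(2)] by (simp add: power_strict_mono)
    then show "(sin (x / 2))\<^sup>2 / (sin (\<theta> / 2))\<^sup>2 \<noteq> (sin (y / 2))\<^sup>2 / (sin (\<theta> / 2))\<^sup>2"
      using T by (simp add: T_def)
  qed auto
qed

text \<open>The substitution \<open>w = sin\<^sup>2 (u/2) / sin\<^sup>2 (\<theta>/2)\<close> turns this into a Beta integral.\<close>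

lemma integral_sin_power_weight:
  fixes k :: nat
  assumes \<sigma>: "Re \<sigma> > - 1" and \<theta>: "0 < \<theta>" "\<theta> < pi"
  defines "f \<equiv> \<lambda>u. complex_of_real ((sin (u / 2)) ^ (2 * k) * cos (u / 2)) * complex_of_real (cos u - cos \<theta>) powr \<sigma>"
  shows "f absolutely_integrable_on {0..\<theta>}"
    and "integral {0..\<theta>} f = 2 powr \<sigma> * complex_of_real ((sin (\<theta> / 2))\<^sup>2) powr (of_nat k + 1/2 + \<sigma>) * Beta (of_nat k + 1/2) (\<sigma> + 1)"
proof -
  define T where "T = (sin (\<theta> / 2))\<^sup>2"
  have S: "sin (\<theta> / 2) > 0" using \<theta> by (auto intro: sin_gt_zero)
  then have T: "T > 0" by (simp add: T_def)
  define g where "g u = (sin (u / 2))\<^sup>2 / T" for u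
  \<comment> \<open>\<open>h\<close> is the derivative of \<open>g\<close>.\<close>
  define h where "h u = sin (u / 2) * cos (u / 2) / T" for u
  define b where "b w = complex_of_real w powr (of_nat k + 1/2 - 1) * of_real (1 - w) powr (\<sigma> + 1 - 1)" for w
  \<comment> \<open>The constant by which the transformed Beta integrand differs from
    \<open>f\<close>: it collects the factor 2 in cos u - cos \<theta> = 2 (T - sin^2 (u/2)) and all
    powers of T.\<close>
  define K where "K = exp (- \<sigma> * of_real (ln 2) - (of_nat k + 1/2 + \<sigma>) * complex_of_real (ln T))"
  have Re: "Re (of_nat k + 1/2 :: complex) > 0" "Re (\<sigma> + 1) > 0" using \<sigma> by auto
  have bint: "set_integrable lborel {0<..<1} b"
    unfolding b_def [abs_def] by (rule set_integrable_Beta_complex[OF Re])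
  have "b absolutely_integrable_on {0<..<1}"
    using bint unfolding set_integrable_def
    by (subst integrable_completion) (auto dest: borel_measurable_integrable)
  moreover have "integral {0<..<1} b = Beta (of_nat k + 1/2) (\<sigma> + 1)"
    using set_borel_integral_eq_integral(2)[OF bint] integral_Beta_complex[OF Re]
    unfolding b_def [abs_def] by simp
  moreover have "g ` {0<..<\<theta>} = {0<..<1}" "inj_on g {0<..<\<theta>}"
    unfolding g_def [abs_def] T_def by (rule sin_half_square_image[OF \<theta>])+
  moreover have "(g has_field_derivative h u) (at u within {0<..<\<theta>})" for u
    unfolding g_def [abs_def] h_def using T by (auto intro!: derivative_eq_intros)
  ultimately have *: "(\<lambda>u. \<bar>h u\<bar> *\<^sub>R b (g u)) absolutely_integrable_on {0<..<\<theta>}"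
      "integral {0<..<\<theta>} (\<lambda>u. \<bar>h u\<bar> *\<^sub>R b (g u)) = Beta (of_nat k + 1/2) (\<sigma> + 1)"
    using has_absolute_integral_change_of_variables_real[of "{0<..<\<theta>}" g h b "Beta (of_nat k + 1/2) (\<sigma> + 1)"]
    by auto
  \<comment> \<open>All bases are positive, so every power becomes the exponential of a real
    logarithm and the claim reduces to a linear identity between exponents.\<close>
  have eq: "\<bar>h u\<bar> *\<^sub>R b (g u) = K * f u" if u: "u \<in> {0<..<\<theta>}" for u
  proof -
    define s where "s = sin (u / 2)"
    define C where "C = cos (u / 2)"
    have s: "s > 0" using u \<theta> by (auto simp: s_def intro: sin_gt_zero)
    have C: "C > 0" using u \<theta> by (auto simp: C_def intro: cos_gt_zero_pi)
    have "s < sin (\<theta> / 2)" using u \<theta> by (auto simp: s_def intro!: sin_monotone_2pi)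
    then have sT: "s\<^sup>2 < T" using s by (simp add: T_def power_strict_mono)
    have ln1: "ln (s\<^sup>2 / T) = 2 * ln s - ln T" using s T by (simp add: ln_div ln_realpow)
    have ln2: "ln (1 - s\<^sup>2 / T) = ln (T - s\<^sup>2) - ln T"
    proof -
      have "1 - s\<^sup>2 / T = (T - s\<^sup>2) / T" using T by (simp add: field_simps)
      then show ?thesis using sT T by (simp add: ln_div)
    qed
    have ln3: "ln (2 * (T - s\<^sup>2)) = ln 2 + ln (T - s\<^sup>2)" using sT ln_mult[of 2 "T - s\<^sup>2"] by simp
    have e1: "complex_of_real s = exp (of_real (ln s))" "complex_of_real T = exp (of_real (ln T))"
      using s T by (simp_all add: exp_of_real)
    have e2: "complex_of_real s ^ (2 * k) = exp (of_nat (2 * k) * of_real (ln s))"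
      unfolding e1(1) by (rule exp_of_nat_mult[symmetric])
    have c: "cos u - cos \<theta> = 2 * (T - s\<^sup>2)"
      unfolding T_def s_def by (rule cos_diff_eq_sin_half_squares)
    have "\<bar>h u\<bar> *\<^sub>R b (g u) = complex_of_real C * (complex_of_real s / of_real T) *
        (exp ((of_nat k + 1/2 - 1) * of_real (ln (s\<^sup>2 / T))) * exp ((\<sigma> + 1 - 1) * of_real (ln (1 - s\<^sup>2 / T))))"
      unfolding b_def h_def g_def s_def[symmetric] C_def[symmetric]
      using s C T sT by (subst (1 2) of_real_powr_eq_exp) (auto simp: scaleR_conv_of_real)
    also have "\<dots> = complex_of_real C * exp (of_real (ln s) - of_real (ln T) + (of_nat k + 1/2 - 1) * of_real (ln (s\<^sup>2 / T)) + (\<sigma> + 1 - 1) * of_real (ln (1 - s\<^sup>2 / T)))"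
      unfolding e1 by (simp add: exp_add exp_diff)
    also have "of_real (ln s) - of_real (ln T) + (of_nat k + 1/2 - 1) * of_real (ln (s\<^sup>2 / T)) + (\<sigma> + 1 - 1) * of_real (ln (1 - s\<^sup>2 / T)) =
       (- \<sigma> * of_real (ln 2) - (of_nat k + 1/2 + \<sigma>) * complex_of_real (ln T)) + (of_nat (2 * k) * of_real (ln s) + \<sigma> * of_real (ln (2 * (T - s\<^sup>2))))"
      unfolding ln1 ln2 ln3 by (simp add: field_simps)
    also have "complex_of_real C * exp \<dots> = K * (complex_of_real s ^ (2 * k) * of_real C * (complex_of_real (2 * (T - s\<^sup>2)) powr \<sigma>))"
      unfolding e2 K_def exp_add using sT by (subst of_real_powr_eq_exp) (auto simp: mult_ac)
    also have "\<dots> = K * f u"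
      unfolding f_def c s_def C_def by (simp only: of_real_mult of_real_power)
    finally show ?thesis .
  qed
  have K: "K \<noteq> 0" by (simp add: K_def)
  have "(\<lambda>u. K * f u) absolutely_integrable_on {0<..<\<theta>}"
    using *(1) by (rule absolutely_integrable_spike[where S = "{}"]) (auto simp: eq)
  then have "(\<lambda>u. inverse K * (K * f u)) absolutely_integrable_on {0<..<\<theta>}"
    by (rule set_integrable_mult_right)
  then have "f absolutely_integrable_on {0<..<\<theta>}" using K by (simp flip: mult.assoc)
  then show "f absolutely_integrable_on {0..\<theta>}"
    by (simp add: absolutely_integrable_on_Icc_iff_Ioo)
  have "K * integral {0..\<theta>} f = integral {0<..<\<theta>} (\<lambda>u. K * f u)"
    using integral_open_interval_real[of 0 \<theta> f] by simp
  also have "\<dots> = integral {0<..<\<theta>} (\<lambda>u. \<bar>h u\<bar> *\<^sub>R b (g u))"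
    by (intro integral_cong) (simp add: eq)
  finally have "K * integral {0..\<theta>} f = Beta (of_nat k + 1/2) (\<sigma> + 1)" using *(2) by simp
  moreover have "2 powr \<sigma> * complex_of_real T powr (of_nat k + 1/2 + \<sigma>) = inverse K"
  proof -
    have "2 powr \<sigma> * complex_of_real T powr (of_nat k + 1/2 + \<sigma>) = exp (\<sigma> * of_real (ln 2)) * exp ((of_nat k + 1/2 + \<sigma>) * of_real (ln T))"
      using of_real_powr_eq_exp[of 2 \<sigma>] of_real_powr_eq_exp[OF T] by simp
    then show ?thesis
      unfolding K_def exp_minus[symmetric] exp_add[symmetric] by (simp add: algebra_simps)
  qed
  moreover have "integral {0..\<theta>} f = inverse K * (K * integral {0..\<theta>} f)"
    by (simp only: mult.assoc[symmetric] left_inverse[OF K] mult_1_left)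
  ultimately show "integral {0..\<theta>} f = 2 powr \<sigma> * complex_of_real ((sin (\<theta> / 2))\<^sup>2) powr (of_nat k + 1/2 + \<sigma>) * Beta (of_nat k + 1/2) (\<sigma> + 1)"
    unfolding T_def[symmetric] by (simp only:)
qed

text \<open>The case k = 0 of the previous integral carries an extra factor cos (u/2), which is
  positive on the closed interval since \<theta> < \<pi> and can be divided out.\<close>

lemma weight_absolutely_integrable:
  assumes "Re \<sigma> > - 1" "0 < \<theta>" "\<theta> < pi"
  shows "(\<lambda>u. complex_of_real (cos u - cos \<theta>) powr \<sigma>) absolutely_integrable_on {0..\<theta>}"
proof -
  have C: "cos (u / 2) > 0" if "u \<in> {0..\<theta>}" for u
    using that assms by (intro cos_gt_zero_pi) auto
  have "continuous_on {0..\<theta>} (\<lambda>u. complex_of_real (1 / cos (u / 2)))"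
    by (intro continuous_intros) (use C in force)+
  from absolutely_integrable_continuous_times[OF this integral_sin_power_weight(1)[OF assms, of 0]]
  show ?thesis
    by (rule absolutely_integrable_spike[where S = "{}"]) (use C in force)+
qed

text \<open>The expansion of cos (\<nu> u) is integrated term by term. The Beta values turn the
  coefficients with lower parameter 1/2 into those of the regularized series with lower parameter
  \<sigma> + 3/2.\<close>

lemma Mehler_Dirichlet:
  assumes \<sigma>: "Re \<sigma> > - 1" and \<theta>: "0 < \<theta>" "\<theta> < pi"
  shows "integral {0..\<theta>} (\<lambda>u. cos (\<nu> * of_real u) * complex_of_real (cos u - cos \<theta>) powr \<sigma>) =
    2 powr \<sigma> * of_real (sqrt pi) * Gamma (\<sigma> + 1) * complex_of_real ((sin (\<theta> / 2))\<^sup>2) powr (\<sigma> + 1/2) *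
    hyp2F1_reg (1/2 - \<nu>) (1/2 + \<nu>) (\<sigma> + 3/2) (complex_of_real ((sin (\<theta> / 2))\<^sup>2))"
proof -
  define T where "T = (sin (\<theta> / 2))\<^sup>2"
  have S: "sin (\<theta> / 2) > 0" using \<theta> by (auto intro: sin_gt_zero)
  then have T: "T > 0" by (simp add: T_def)
  have "cos (\<theta> / 2) > 0" using \<theta> by (intro cos_gt_zero_pi) auto
  then have "(cos (\<theta> / 2))\<^sup>2 > 0" by simp
  then have T1: "T < 1" using sin_cos_squared_add[of "\<theta> / 2"] unfolding T_def by linarith
  define f where "f k = (\<lambda>u. complex_of_real (sin (u / 2) ^ (2 * k) * cos (u / 2)) * complex_of_real (cos u - cos \<theta>) powr \<sigma>)" for k
  define X where "X = 2 powr \<sigma> * of_real (sqrt pi) * Gamma (\<sigma> + 1) * complex_of_real T powr (\<sigma> + 1/2)"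
  define tm where "tm k = pochhammer (1/2 - \<nu>) k * pochhammer (1/2 + \<nu>) k * rGamma (\<sigma> + 3/2 + of_nat k) / fact k * complex_of_real T ^ k" for k
  define M where "M = (\<Sum>k. norm (hyp_half_coeff \<nu> k) * T ^ k)"
  let ?I = "integral {0..\<theta>} (\<lambda>u. cos (\<nu> * of_real u) * complex_of_real (cos u - cos \<theta>) powr \<sigma>)"
  note fint = integral_sin_power_weight(1)[OF \<sigma> \<theta>, folded f_def]
    and fval = integral_sin_power_weight(2)[OF \<sigma> \<theta>, folded f_def T_def]
  have fint': "f k integrable_on {0..\<theta>}" for k
    using fint[of k] by (simp add: f_def [abs_def] set_lebesgue_integral_eq_integral(1))
  \<comment> \<open>Convergence at (T + 1)/2, strictly between T and 1, gives absolute convergence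
    at T; the sum M times |\<open>f 0\<close>| then dominates all partial sums.\<close>
  have abs_sum: "summable (\<lambda>k. norm (hyp_half_coeff \<nu> k) * T ^ k)"
  proof -
    have "norm (complex_of_real ((T + 1) / 2)) < 1" using T T1 by (simp only: norm_of_real) simp
    then have "summable (\<lambda>k. hyp_half_coeff \<nu> k * complex_of_real ((T + 1) / 2) ^ k)"
      by (rule summable_hyp_half_coeff)
    moreover have "norm (complex_of_real T) < norm (complex_of_real ((T + 1) / 2))"
      using T T1 by (simp only: norm_of_real) simp
    ultimately have "summable (\<lambda>k. norm (hyp_half_coeff \<nu> k * complex_of_real T ^ k))"
      by (rule powser_insidea)
    then show ?thesis using T by (simp add: norm_mult norm_power)
  qed
  have s_bounds: "0 \<le> sin (u / 2)" "(sin (u / 2))\<^sup>2 \<le> T" if "u \<in> {0..\<theta>}" for u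
  proof -
    show "0 \<le> sin (u / 2)" using that \<theta> by (intro sin_ge_zero) auto
    moreover have "sin (u / 2) \<le> sin (\<theta> / 2)" using that \<theta> by (intro sin_monotone_2pi_le) auto
    ultimately show "(sin (u / 2))\<^sup>2 \<le> T" unfolding T_def by (intro power_mono)
  qed
  have f0: "(\<lambda>u. norm (f 0 u)) integrable_on {0..\<theta>}"
    using fint[of 0] unfolding absolutely_integrable_on_def by (simp add: f_def)
  have "(\<lambda>n. integral {0..\<theta>} (\<lambda>u. \<Sum>k<n. hyp_half_coeff \<nu> k * f k u)) \<longlonglongrightarrow> ?I"
  proof (rule dominated_convergence(2))
    show "(\<lambda>u. \<Sum>k<n. hyp_half_coeff \<nu> k * f k u) integrable_on {0..\<theta>}" for n
      by (intro integrable_sum integrable_on_mult_right fint') auto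
    show "(\<lambda>u. M * norm (f 0 u)) integrable_on {0..\<theta>}"
      by (intro integrable_on_mult_right f0)
  next
    fix n u assume u: "u \<in> {0..\<theta>}"
    have fk: "f k u = complex_of_real (sin (u / 2)) ^ (2 * k) * f 0 u" for k
      by (simp add: f_def)
    note s0 = s_bounds(1)[OF u] and sT = s_bounds(2)[OF u]
    have "norm (\<Sum>k<n. hyp_half_coeff \<nu> k * f k u) \<le> (\<Sum>k<n. norm (hyp_half_coeff \<nu> k * f k u))"
      by (rule norm_sum)
    also have "\<dots> \<le> (\<Sum>k<n. (norm (hyp_half_coeff \<nu> k) * T ^ k) * norm (f 0 u))"
    proof (rule sum_mono)
      fix k
      have "norm (hyp_half_coeff \<nu> k * f k u) = norm (hyp_half_coeff \<nu> k) * ((sin (u / 2))\<^sup>2) ^ k * norm (f 0 u)"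
        by (subst fk) (simp add: norm_mult norm_power power_mult)
      also have "\<dots> \<le> (norm (hyp_half_coeff \<nu> k) * T ^ k) * norm (f 0 u)"
        using sT by (intro mult_right_mono mult_left_mono power_mono) auto
      finally show "norm (hyp_half_coeff \<nu> k * f k u) \<le> (norm (hyp_half_coeff \<nu> k) * T ^ k) * norm (f 0 u)" .
    qed
    also have "\<dots> \<le> M * norm (f 0 u)"
      unfolding sum_distrib_right[symmetric] M_def using T
      by (intro mult_right_mono sum_le_suminf abs_sum) auto
    finally show "norm (\<Sum>k<n. hyp_half_coeff \<nu> k * f k u) \<le> M * norm (f 0 u)" .
  next
    fix u assume u: "u \<in> {0..\<theta>}"
    note s0 = s_bounds(1)[OF u] and sT = s_bounds(2)[OF u]
    have sin_eq: "sin (complex_of_real u / 2) = of_real (sin (u / 2))" "cos (complex_of_real u / 2) = of_real (cos (u / 2))"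
      using sin_of_real[of "u / 2", where 'a = complex] cos_of_real[of "u / 2", where 'a = complex] by simp_all
    have "norm ((sin (complex_of_real u / 2))\<^sup>2) < 1"
      using sT T1 by (simp add: sin_eq norm_power)
    then have "(\<lambda>k. hyp_half_coeff \<nu> k * ((sin (complex_of_real u / 2))\<^sup>2) ^ k) sums hyp_half \<nu> ((sin (complex_of_real u / 2))\<^sup>2)"
      unfolding hyp_half_def by (intro summable_sums summable_hyp_half_coeff)
    from sums_mult2[OF this, of "cos (complex_of_real u / 2) * complex_of_real (cos u - cos \<theta>) powr \<sigma>"]
    have "(\<lambda>k. hyp_half_coeff \<nu> k * f k u) sums (hyp_half \<nu> ((sin (complex_of_real u / 2))\<^sup>2) * (cos (complex_of_real u / 2) * complex_of_real (cos u - cos \<theta>) powr \<sigma>))"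
      unfolding f_def of_real_mult of_real_power power_mult sin_eq by (simp only: mult_ac)
    moreover have "cos (\<nu> * of_real u) = cos (of_real u / 2) * hyp_half \<nu> ((sin (of_real u / 2))\<^sup>2)"
      by (rule cos_eq_hyp_half) (use u \<theta> in auto)
    ultimately show "(\<lambda>n. \<Sum>k<n. hyp_half_coeff \<nu> k * f k u) \<longlonglongrightarrow> cos (\<nu> * of_real u) * complex_of_real (cos u - cos \<theta>) powr \<sigma>"
      by (simp add: sums_def mult_ac)
  qed
  moreover have "integral {0..\<theta>} (\<lambda>u. \<Sum>k<n. hyp_half_coeff \<nu> k * f k u) = X * (\<Sum>k<n. tm k)" for n
  proof -
    \<comment> \<open>The factor Gamma (1/2 + k) of the Beta value cancels against the Pochhammer
      symbol of 1/2, leaving sqrt \<pi>.\<close>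
    have "hyp_half_coeff \<nu> k * integral {0..\<theta>} (f k) = X * tm k" for k
    proof -
      have half: "(1/2 :: complex) \<notin> \<int>\<^sub>\<le>\<^sub>0"
        by (auto elim!: nonpos_Ints_cases simp: complex_eq_iff)
      have ph: "pochhammer (1/2 :: complex) k = Gamma (1/2 + of_nat k) / of_real (sqrt pi)"
        using pochhammer_Gamma[OF half, of k] by (simp add: Gamma_one_half_complex)
      have "(1/2 + of_nat k :: complex) \<notin> \<int>\<^sub>\<le>\<^sub>0"
        by (auto elim!: nonpos_Ints_cases simp: complex_eq_iff)
      then have nz: "Gamma (1/2 + of_nat k :: complex) \<noteq> 0" by (rule Gamma_nonzero)
      have p: "complex_of_real T powr (of_nat k + 1/2 + \<sigma>) = complex_of_real T powr (\<sigma> + 1/2) * complex_of_real T ^ k"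
        using T by (simp add: powr_add powr_nat' mult_ac)
      have B: "Beta (of_nat k + 1/2) (\<sigma> + 1) = Gamma (1/2 + of_nat k) * Gamma (\<sigma> + 1) * rGamma (\<sigma> + 3/2 + of_nat k)"
        by (simp add: Beta_altdef add_ac)
      show ?thesis
        unfolding fval p B X_def tm_def hyp_half_coeff_def ph using nz by (simp add: field_simps)
    qed
    then show ?thesis
      by (subst integral_sum) (auto intro!: integrable_on_mult_right fint' simp: sum_distrib_left)
  qed
  ultimately have lim: "(\<lambda>n. X * (\<Sum>k<n. tm k)) \<longlonglongrightarrow> ?I" by simp
  have "\<sigma> + 1 \<notin> \<int>\<^sub>\<le>\<^sub>0" using \<sigma> by (auto elim!: nonpos_Ints_cases simp: complex_eq_iff)
  then have X: "X \<noteq> 0" using T by (simp add: X_def Gamma_nonzero powr_def)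
  \<comment> \<open>Dividing by the nonzero constant X yields convergence of the regularized series
    together with its sum.\<close>
  have "(\<lambda>n. inverse X * (X * (\<Sum>k<n. tm k))) \<longlonglongrightarrow> inverse X * ?I"
    by (intro tendsto_mult lim tendsto_const)
  then have "tm sums (inverse X * ?I)" using X by (simp add: sums_def flip: mult.assoc)
  then have "hyp2F1_reg (1/2 - \<nu>) (1/2 + \<nu>) (\<sigma> + 3/2) (complex_of_real T) = inverse X * ?I"
    by (simp add: hyp2F1_reg_def tm_def [abs_def] sums_iff)
  then have "?I = X * hyp2F1_reg (1/2 - \<nu>) (1/2 + \<nu>) (\<sigma> + 3/2) (complex_of_real T)"
    using X by simp
  then show ?thesis unfolding X_def T_def .
qed

text \<open>The Mehler-Dirichlet formula at \<sigma> = - \<mu> - 1/2. Half-angle formulas express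
  all elementary factors through s = sin (\<theta>/2) and c = cos (\<theta>/2), and the powers of c
  cancel.\<close>

lemma Ferrers_P_eq_integral:
  assumes \<mu>: "Re \<mu> < 1 / 2" and \<theta>: "0 < \<theta>" "\<theta> < pi"
  shows "Ferrers_P (\<nu> - 1/2) \<mu> (cos \<theta>) / (of_real (sqrt pi) * of_real (sin \<theta>) powr \<mu>) =
    of_real (sqrt 2) / of_real pi * rGamma (- \<mu> - 1/2 + 1) *
    integral {0..\<theta>} (\<lambda>u. cos (\<nu> * of_real u) * complex_of_real (cos u - cos \<theta>) powr (- \<mu> - 1/2))"
proof -
  define s where "s = sin (\<theta> / 2)"
  define c where "c = cos (\<theta> / 2)"
  have s: "s > 0" using \<theta> by (auto simp: s_def intro: sin_gt_zero)
  have c: "c > 0" using \<theta> by (auto simp: c_def intro: cos_gt_zero_pi)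
  have sc: "s\<^sup>2 + c\<^sup>2 = 1" by (simp add: s_def c_def)
  have x: "(1 - cos \<theta>) / 2 = s\<^sup>2" "(1 - cos \<theta>) / (1 + cos \<theta>) = s\<^sup>2 / c\<^sup>2" "sin \<theta> = 2 * s * c"
    using cos_double_sin[of "\<theta> / 2"] cos_double_cos[of "\<theta> / 2"] sin_double[of "\<theta> / 2"]
    by (simp_all add: s_def c_def)
  have ln: "ln (s\<^sup>2 / c\<^sup>2) = 2 * ln s - 2 * ln c" "ln (2 * s * c) = ln 2 + ln s + ln c" "ln (s\<^sup>2) = 2 * ln s" "ln (sqrt 2) = ln 2 / 2"
    using s c by (simp_all add: ln_div ln_realpow ln_mult ln_sqrt)
  have e: "complex_of_real (s\<^sup>2 / c\<^sup>2) powr (- \<mu> / 2) = exp (- \<mu> / 2 * of_real (2 * ln s - 2 * ln c))"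
     "complex_of_real (2 * s * c) powr \<mu> = exp (\<mu> * of_real (ln 2 + ln s + ln c))"
     "complex_of_real (s\<^sup>2) powr (- \<mu> - 1/2 + 1/2) = exp ((- \<mu> - 1/2 + 1/2) * of_real (2 * ln s))"
     "2 powr (- \<mu> - 1/2) = exp ((- \<mu> - 1/2) * of_real (ln 2))"
  proof -
    show "complex_of_real (s\<^sup>2 / c\<^sup>2) powr (- \<mu> / 2) = exp (- \<mu> / 2 * of_real (2 * ln s - 2 * ln c))"
      by (subst of_real_powr_eq_exp) (use s c ln(1) in simp_all)
    show "complex_of_real (2 * s * c) powr \<mu> = exp (\<mu> * of_real (ln 2 + ln s + ln c))"
      by (subst of_real_powr_eq_exp) (use s c ln(2) in simp_all)
    show "complex_of_real (s\<^sup>2) powr (- \<mu> - 1/2 + 1/2) = exp ((- \<mu> - 1/2 + 1/2) * of_real (2 * ln s))"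
      by (subst of_real_powr_eq_exp) (use s ln(3) in simp_all)
    show "2 powr (- \<mu> - 1/2) = exp ((- \<mu> - 1/2) * complex_of_real (ln 2))"
      using of_real_powr_eq_exp[of 2] by simp
  qed
  have sq: "complex_of_real (sqrt 2) = exp (of_real (ln 2 / 2))"
  proof -
    have "exp (ln 2 / 2) = sqrt 2" using exp_ln[of "sqrt 2"] unfolding ln(4) by simp
    then show ?thesis by (simp only: exp_of_real)
  qed
  have pi: "complex_of_real (sqrt pi) * complex_of_real (sqrt pi) = of_real pi"
    by (simp flip: of_real_mult)
  \<comment> \<open>Since Re \<mu> < 1/2, this argument has positive real part, so Gamma times
    rGamma is 1 and may be inserted below.\<close>
  have "- \<mu> - 1/2 + 1 \<notin> \<int>\<^sub>\<le>\<^sub>0" using \<mu> by (auto elim!: nonpos_Ints_cases simp: complex_eq_iff)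
  then have G: "rGamma (- \<mu> - 1/2 + 1) * Gamma (- \<mu> - 1/2 + 1) = 1"
    by (simp add: rGamma_inverse_Gamma Gamma_eq_zero_iff)
  define F where "F = hyp2F1_reg (1/2 - \<nu>) (1/2 + \<nu>) (1 - \<mu>) (of_real (s\<^sup>2))"
  have "Ferrers_P (\<nu> - 1/2) \<mu> (cos \<theta>) / (of_real (sqrt pi) * of_real (sin \<theta>) powr \<mu>) =
     exp (- \<mu> / 2 * of_real (2 * ln s - 2 * ln c)) * F / (of_real (sqrt pi) * exp (\<mu> * of_real (ln 2 + ln s + ln c)))"
    unfolding Ferrers_P_def x e F_def by (simp add: add.commute)
  also have "\<dots> = exp (- \<mu> * of_real (ln 2) - \<mu> * of_real (2 * ln s)) * F / of_real (sqrt pi)"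
  proof -
    have "exp (- \<mu> / 2 * of_real (2 * ln s - 2 * ln c)) / exp (\<mu> * of_real (ln 2 + ln s + ln c)) =
       exp (- \<mu> * of_real (ln 2) - \<mu> * of_real (2 * ln s))"
      unfolding exp_diff[symmetric] by (rule arg_cong[where f = exp]) (simp add: algebra_simps)
    then have "exp (- \<mu> / 2 * of_real (2 * ln s - 2 * ln c)) =
       exp (- \<mu> * of_real (ln 2) - \<mu> * of_real (2 * ln s)) * exp (\<mu> * complex_of_real (ln 2 + ln s + ln c))"
      by (simp only: nonzero_divide_eq_eq[OF exp_not_eq_zero])
    then show ?thesis by simp
  qed
  also have "\<dots> = of_real (sqrt 2) / of_real pi * (rGamma (- \<mu> - 1/2 + 1) * Gamma (- \<mu> - 1/2 + 1)) *
      (2 powr (- \<mu> - 1/2) * of_real (sqrt pi) * complex_of_real (s\<^sup>2) powr (- \<mu> - 1/2 + 1/2) * F)"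
  proof -
    have "exp (of_real (ln 2 / 2)) * exp ((- \<mu> - 1/2) * complex_of_real (ln 2)) * exp ((- \<mu> - 1/2 + 1/2) * of_real (2 * ln s)) =
       exp (- \<mu> * of_real (ln 2) - \<mu> * of_real (2 * ln s))"
      unfolding exp_add[symmetric] by (rule arg_cong[where f = exp]) (simp add: field_simps)
    moreover have "E1 / (p * p) * 1 * (E2 * p * E3 * F) = (E1 * E2 * E3) * F / p" if "p \<noteq> 0" for E1 E2 E3 p :: complex
      using that by (simp add: field_simps)
    ultimately show ?thesis
      unfolding G e sq pi[symmetric] by (simp only: of_real_eq_0_iff real_sqrt_eq_zero_cancel_iff pi_neq_zero not_False_eq_True)
  qed
  also have "\<dots> = of_real (sqrt 2) / of_real pi * rGamma (- \<mu> - 1/2 + 1) *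
      (2 powr (- \<mu> - 1/2) * of_real (sqrt pi) * Gamma (- \<mu> - 1/2 + 1) * complex_of_real (s\<^sup>2) powr (- \<mu> - 1/2 + 1/2) * F)"
    by (simp only: mult_ac)
  also have "2 powr (- \<mu> - 1/2) * of_real (sqrt pi) * Gamma (- \<mu> - 1/2 + 1) * complex_of_real (s\<^sup>2) powr (- \<mu> - 1/2 + 1/2) * F =
     integral {0..\<theta>} (\<lambda>u. cos (\<nu> * of_real u) * complex_of_real (cos u - cos \<theta>) powr (- \<mu> - 1/2))"
  proof -
    have "- \<mu> - 1/2 + 3/2 = 1 - \<mu>" "Re (- \<mu> - 1/2) > - 1" using \<mu> by simp_all
    from Mehler_Dirichlet[OF this(2) \<theta>, of \<nu>, unfolded this(1)] show ?thesis
      unfolding F_def s_def by (rule sym)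
  qed
  finally show ?thesis .
qed

section \<open>The Bessel integrals\<close>

text \<open>Both Y are replaced by their quotients. Cosine and sine change sign when \<nu> grows by
  1, so the terms with J of orders \<nu> + 1 and \<nu> cancel.\<close>

lemma Bessel_chi_not_Ints:
  assumes "\<nu> \<notin> \<int>"
  shows "Bessel_chi (\<nu> + 1) \<nu> l u =
    - (Bessel_J (\<nu> + 1) (l - \<i> * of_real u / 2) * Bessel_J (- \<nu>) (l + \<i> * of_real u / 2) +
       Bessel_J (- \<nu> - 1) (l - \<i> * of_real u / 2) * Bessel_J \<nu> (l + \<i> * of_real u / 2)) / sin (of_real pi * \<nu>)"
proof -
  define S where "S = sin (complex_of_real pi * \<nu>)"
  define c where "c = cos (complex_of_real pi * \<nu>)"
  define J1 where "J1 = Bessel_J (\<nu> + 1) (l - \<i> * of_real u / 2)"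
  define J2 where "J2 = Bessel_J (- \<nu> - 1) (l - \<i> * of_real u / 2)"
  define J3 where "J3 = Bessel_J \<nu> (l + \<i> * of_real u / 2)"
  define J4 where "J4 = Bessel_J (- \<nu>) (l + \<i> * of_real u / 2)"
  have "\<nu> + 1 \<notin> \<int>" using assms Ints_diff[of "\<nu> + 1" 1] by auto
  moreover have "sin (complex_of_real pi * (\<nu> + 1)) = - S" "cos (complex_of_real pi * (\<nu> + 1)) = - c"
    by (simp_all add: distrib_left sin_add cos_add sin_of_real cos_of_real S_def c_def)
  moreover have "- (\<nu> + 1) = - \<nu> - 1" by simp
  ultimately have Y1: "Bessel_Y (\<nu> + 1) (l - \<i> * of_real u / 2) = (J1 * (- c) - J2) / (- S)"
    by (simp only: Bessel_Y_not_Ints Y_quot_def J1_def J2_def not_False_eq_True)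
  have Y0: "Bessel_Y \<nu> (l + \<i> * of_real u / 2) = (J3 * c - J4) / S"
    by (simp only: Bessel_Y_not_Ints[OF assms] Y_quot_def J3_def J4_def S_def c_def)
  have "S \<noteq> 0" using assms by (simp add: sin_pi_eq_0_iff S_def)
  then show ?thesis
    unfolding Bessel_chi_def Y0 Y1 J1_def[symmetric] J2_def[symmetric] J3_def[symmetric] J4_def[symmetric] S_def[symmetric]
    by (simp add: field_simps)
qed

text \<open>Turning \<xi> by the angle u/2 turns \<xi>^2 / 4 by the full angle u, while the power in
  front keeps track of the chosen logarithm.\<close>

lemma Bessel_J_shift:
  defines "y \<equiv> \<lambda>l. (exp l / 2)\<^sup>2"
  shows "Bessel_J s (l - \<i> * of_real u / 2) = exp (s * (l - \<i> * of_real u / 2 - of_real (ln 2))) * bes s (y l * exp (- (\<i> * of_real u)))"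
    and "Bessel_J s (l + \<i> * of_real u / 2) = exp (s * (l + \<i> * of_real u / 2 - of_real (ln 2))) * bes s (y l * exp (\<i> * of_real u))"
proof -
  have sq: "(exp x / 2)\<^sup>2 = exp (2 * x) / 4" for x :: complex
    by (simp add: power2_eq_square flip: exp_add)
  have "(exp (l - \<i> * of_real u / 2) / 2)\<^sup>2 = y l * exp (- (\<i> * of_real u))"
    "(exp (l + \<i> * of_real u / 2) / 2)\<^sup>2 = y l * exp (\<i> * of_real u)"
  proof -
    have "2 * (l - \<i> * of_real u / 2) = 2 * l + - (\<i> * of_real u)" "2 * (l + \<i> * of_real u / 2) = 2 * l + \<i> * of_real u"
      by (simp_all add: field_simps)
    then show "(exp (l - \<i> * of_real u / 2) / 2)\<^sup>2 = y l * exp (- (\<i> * of_real u))"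
      "(exp (l + \<i> * of_real u / 2) / 2)\<^sup>2 = y l * exp (\<i> * of_real u)"
      unfolding y_def sq by (simp_all only: exp_add times_divide_eq_left)
  qed
  then show "Bessel_J s (l - \<i> * of_real u / 2) = exp (s * (l - \<i> * of_real u / 2 - of_real (ln 2))) * bes s (y l * exp (- (\<i> * of_real u)))"
    "Bessel_J s (l + \<i> * of_real u / 2) = exp (s * (l + \<i> * of_real u / 2 - of_real (ln 2))) * bes s (y l * exp (\<i> * of_real u))"
    unfolding Bessel_J_eq_bes by simp_all
qed

text \<open>The orders \<nu> + 1 and - \<nu> leave a factor \<xi>, the orders - \<nu> - 1 and \<nu>
  a factor 1/\<xi>. Multiplication by \<open>exp l\<close> makes these \<xi>^2 = 4 y and 1, so the
  result depends on \<xi> only through y.\<close>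

lemma Bessel_chi_eq_bes:
  assumes "\<nu> \<notin> \<int>"
  defines "y \<equiv> \<lambda>l. (exp l / 2)\<^sup>2"
  shows "exp l * (exp (- (\<i> * of_real u / 2)) * Bessel_chi (\<nu> + 1) \<nu> l u) = - 2 / sin (of_real pi * \<nu>) *
    (y l * exp (- (\<i> * of_real u)) * exp (- (\<i> * \<nu> * of_real u)) *
       bes (- \<nu>) (y l * exp (\<i> * of_real u)) * bes (\<nu> + 1) (y l * exp (- (\<i> * of_real u))) +
     exp (\<i> * \<nu> * of_real u) * bes (- \<nu> - 1) (y l * exp (- (\<i> * of_real u))) * bes \<nu> (y l * exp (\<i> * of_real u)))"
proof -
  define L where "L = complex_of_real (ln 2)"
  have L: "exp L = 2" by (simp add: L_def exp_of_real)
  define A where "A = y l * exp (- (\<i> * of_real u))"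
  define B where "B = y l * exp (\<i> * of_real u)"
  have yl: "y l = exp (2 * l - 2 * L)"
  proof -
    have "exp l / 2 = exp (l - L)" by (simp add: exp_diff L)
    then show ?thesis
      unfolding y_def power2_eq_square by (simp only: exp_add[symmetric]) (simp add: algebra_simps)
  qed
  have J: "Bessel_J s (l - \<i> * of_real u / 2) = exp (s * (l - \<i> * of_real u / 2 - L)) * bes s A"
     "Bessel_J s (l + \<i> * of_real u / 2) = exp (s * (l + \<i> * of_real u / 2 - L)) * bes s B" for s
    unfolding A_def B_def L_def y_def by (rule Bessel_J_shift)+
  have e1: "exp l * (exp (- (\<i> * of_real u / 2)) * (exp ((\<nu> + 1) * (l - \<i> * of_real u / 2 - L)) * exp (- \<nu> * (l + \<i> * of_real u / 2 - L)))) =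
      exp L * (y l * exp (- (\<i> * of_real u)) * exp (- (\<i> * \<nu> * of_real u)))"
    unfolding yl exp_add[symmetric] by (rule arg_cong[where f = exp]) (simp add: field_simps)
  have e2: "exp l * (exp (- (\<i> * of_real u / 2)) * (exp ((- \<nu> - 1) * (l - \<i> * of_real u / 2 - L)) * exp (\<nu> * (l + \<i> * of_real u / 2 - L)))) =
      exp L * exp (\<i> * \<nu> * of_real u)"
    unfolding exp_add[symmetric] by (rule arg_cong[where f = exp]) (simp add: field_simps)
  have "exp l * (exp (- (\<i> * of_real u / 2)) * Bessel_chi (\<nu> + 1) \<nu> l u) = - 1 / sin (of_real pi * \<nu>) *
     (exp l * (exp (- (\<i> * of_real u / 2)) * (exp ((\<nu> + 1) * (l - \<i> * of_real u / 2 - L)) * exp (- \<nu> * (l + \<i> * of_real u / 2 - L)))) * (bes (\<nu> + 1) A * bes (- \<nu>) B) +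
      exp l * (exp (- (\<i> * of_real u / 2)) * (exp ((- \<nu> - 1) * (l - \<i> * of_real u / 2 - L)) * exp (\<nu> * (l + \<i> * of_real u / 2 - L)))) * (bes (- \<nu> - 1) A * bes \<nu> B))"
  proof -
    have "E * (H * (- (p1 * b1 * (p2 * b2) + p3 * b3 * (p4 * b4)) / S)) =
        - 1 / S * (E * (H * (p1 * p2)) * (b1 * b2) + E * (H * (p3 * p4)) * (b3 * b4))"
      for E H S p1 p2 p3 p4 b1 b2 b3 b4 :: complex
      by (simp add: divide_inverse algebra_simps)
    then show ?thesis unfolding Bessel_chi_not_Ints[OF assms(1)] J .
  qed
  also have "\<dots> = - 2 / sin (of_real pi * \<nu>) * (y l * exp (- (\<i> * of_real u)) * exp (- (\<i> * \<nu> * of_real u)) * bes (- \<nu>) B * bes (\<nu> + 1) A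
     + exp (\<i> * \<nu> * of_real u) * bes (- \<nu> - 1) A * bes \<nu> B)"
    unfolding e1 e2 L by (simp add: algebra_simps)
  finally show ?thesis unfolding A_def B_def .
qed

text \<open>A single chi term is not \<open>bprod'\<close> at u: one of its two summands appears at
  - u. In the sum over u and - u this difference disappears.\<close>

lemma Bessel_chi_hat_eq_bprod':
  assumes "\<nu> \<notin> \<int>"
  defines "y \<equiv> \<lambda>l. (exp l / 2)\<^sup>2"
  shows "exp l * Bessel_chi_hat \<nu> l u =
    - 2 / sin (of_real pi * \<nu>) * (bprod' \<nu> (y l) (of_real u) + bprod' \<nu> (y l) (- of_real u))"
  using Bessel_chi_eq_bes[OF assms(1), of l u] Bessel_chi_eq_bes[OF assms(1), of l "- u"]
  unfolding Bessel_chi_hat_def bprod'_def y_def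
  by (simp add: distrib_left mult_ac)

text \<open>The factor shared by both integrands; it is even in u and contains the endpoint
  singularity.\<close>

definition weight :: "complex \<Rightarrow> real \<Rightarrow> complex \<Rightarrow> real \<Rightarrow> complex" where
  "weight \<mu> \<theta> l u = Bessel_J (- \<mu> - 1/2) (l + of_real (ln (sqrt (2 * (cos u - cos \<theta>))))) /
      of_real (cos u - cos \<theta>) powr ((1 + 2 * \<mu>) / 4)"

text \<open>With \<sigma> = - \<mu> - 1/2, the Bessel function contributes c to the power
  \<sigma>/2, and the denominator is c to the power - \<sigma>/2; together they give c to the power
  \<sigma>.\<close>

lemma weight_eq:
  assumes "cos u - cos \<theta> \<ge> 0"
  shows "weight \<mu> \<theta> l u = exp ((- \<mu> - 1/2) * l) * 2 powr ((1 + 2 * \<mu>) / 4) *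
     (bes (- \<mu> - 1/2) (2 * (exp l / 2)\<^sup>2 * of_real (cos u - cos \<theta>)) * of_real (cos u - cos \<theta>) powr (- \<mu> - 1/2))"
proof (cases "cos u - cos \<theta> = 0")
  \<comment> \<open>At c = 0 both sides are 0, because \<open>0 powr z\<close> and division by zero
    are 0.\<close>
  case True
  then show ?thesis by (simp add: weight_def)
next
  case False
  define c where "c = cos u - cos \<theta>"
  have c: "c > 0" using False assms by (simp add: c_def)
  have ln: "ln (sqrt (2 * c)) = (ln 2 + ln c) / 2" using c by (simp add: ln_sqrt ln_mult)
  have "exp (complex_of_real (ln (sqrt (2 * c)))) = of_real (sqrt (2 * c))"
    using c by (simp add: exp_of_real)
  then have sq: "(exp (l + complex_of_real (ln (sqrt (2 * c)))) / 2)\<^sup>2 = 2 * (exp l / 2)\<^sup>2 * of_real c"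
    using c by (simp add: exp_add power_mult_distrib power_divide flip: of_real_power)
  have p: "complex_of_real c powr ((1 + 2 * \<mu>) / 4) = exp ((1 + 2 * \<mu>) / 4 * of_real (ln c))"
    "complex_of_real c powr (- \<mu> - 1/2) = exp ((- \<mu> - 1/2) * of_real (ln c))"
    "2 powr ((1 + 2 * \<mu>) / 4) = exp ((1 + 2 * \<mu>) / 4 * complex_of_real (ln 2))"
    using c of_real_powr_eq_exp[OF c] of_real_powr_eq_exp[of 2] by simp_all
  have "exp ((- \<mu> - 1/2) * (l + complex_of_real (ln (sqrt (2 * c))) - of_real (ln 2))) / exp ((1 + 2 * \<mu>) / 4 * of_real (ln c)) =
     exp ((- \<mu> - 1/2) * l) * exp ((1 + 2 * \<mu>) / 4 * complex_of_real (ln 2)) * exp ((- \<mu> - 1/2) * of_real (ln c))"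
    unfolding exp_add[symmetric] exp_diff[symmetric] ln
    by (rule arg_cong[where f = exp]) (simp add: field_simps)
  then show ?thesis
    unfolding weight_def c_def[symmetric] Bessel_J_eq_bes sq p times_divide_eq_left[symmetric]
    by (simp only: mult_ac)
qed

lemma cos_diff_nonneg:
  assumes "\<bar>u\<bar> \<le> \<theta>" "\<theta> < pi"
  shows "cos u - cos \<theta> \<ge> 0"
  using cos_monotone_0_pi_le[of "\<bar>u\<bar>" \<theta>] assms by simp

lemma integrand_hat_eq_weight: "integrand_hat \<nu> \<mu> \<theta> l u = Bessel_chi_hat \<nu> l u * weight \<mu> \<theta> l u"
  by (simp add: integrand_hat_def weight_def)

lemma integrand_chi_eq_weight:
  "integrand_chi \<nu> \<mu> \<theta> l u = (exp (- (\<i> * of_real u / 2)) * Bessel_chi (\<nu> + 1) \<nu> l u) * weight \<mu> \<theta> l u"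
  by (simp add: integrand_chi_def weight_def exp_minus field_simps)

lemma integrand_hat_eq_chi: "integrand_hat \<nu> \<mu> \<theta> l u = integrand_chi \<nu> \<mu> \<theta> l u + integrand_chi \<nu> \<mu> \<theta> l (- u)"
proof -
  have "weight \<mu> \<theta> l (- u) = weight \<mu> \<theta> l u" by (simp add: weight_def)
  then show ?thesis
    unfolding integrand_hat_eq_weight integrand_chi_eq_weight Bessel_chi_hat_def by (simp add: algebra_simps)
qed

section \<open>Absolute integrability, equality of the two integrals, non-integer order\<close>

context
  fixes \<mu> :: complex and \<theta> :: real
  assumes \<mu>: "Re \<mu> < 1 / 2" and \<theta>: "0 < \<theta>" "\<theta> < pi"
begin

text \<open>By \<open>weight_eq\<close> the weight is a continuous factor times a power of cos u -
  cos \<theta>; that power is even, so reflection extends its integrability to the left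
  half.\<close>

lemma weight_absolutely_integrable_symmetric:
  "weight \<mu> \<theta> l absolutely_integrable_on {- \<theta>..\<theta>}"
proof -
  have Re: "Re (- \<mu> - 1/2) > - 1" using \<mu> by simp
  let ?g = "\<lambda>u. complex_of_real (cos u - cos \<theta>) powr (- \<mu> - 1/2)"
  have 1: "?g absolutely_integrable_on {0..\<theta>}"
    by (rule weight_absolutely_integrable[OF Re \<theta>])
  have "(\<lambda>u. ?g (- u)) absolutely_integrable_on {- \<theta>..- 0}"
    using 1 by (subst absolutely_integrable_reflect_real) 
  then have "?g absolutely_integrable_on {- \<theta>..0}" by simp
  then have "?g absolutely_integrable_on ({- \<theta>..0} \<union> {0..\<theta>})"
    using 1 by (rule set_integrable_Un) auto
  also have "{- \<theta>..0} \<union> {0..\<theta>} = {- \<theta>..\<theta>}" using \<theta> by auto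
  finally have g: "?g absolutely_integrable_on {- \<theta>..\<theta>}" .
  have "(\<lambda>u. (exp ((- \<mu> - 1/2) * l) * 2 powr ((1 + 2 * \<mu>) / 4) *
     bes (- \<mu> - 1/2) (2 * (exp l / 2)\<^sup>2 * of_real (cos u - cos \<theta>))) * ?g u) absolutely_integrable_on {- \<theta>..\<theta>}"
    by (rule absolutely_integrable_continuous_times[OF _ g]) (intro continuous_intros)
  then show ?thesis
  proof (rule absolutely_integrable_spike[where S = "{}"])
    fix u assume "u \<in> {- \<theta>..\<theta>} - {}"
    then have "cos u - cos \<theta> \<ge> 0" using \<theta> by (intro cos_diff_nonneg) auto
    then show "weight \<mu> \<theta> l u = (exp ((- \<mu> - 1/2) * l) * 2 powr ((1 + 2 * \<mu>) / 4) *
       bes (- \<mu> - 1/2) (2 * (exp l / 2)\<^sup>2 * of_real (cos u - cos \<theta>))) * ?g u"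
      by (simp only: weight_eq mult.assoc)
  qed auto
qed

lemma integrand_chi_absolutely_integrable: "integrand_chi \<nu> \<mu> \<theta> l absolutely_integrable_on {- \<theta>..\<theta>}"
  unfolding integrand_chi_eq_weight [abs_def]
  by (rule absolutely_integrable_continuous_times[OF _ weight_absolutely_integrable_symmetric])
     (intro continuous_intros, auto)

lemma integrand_hat_absolutely_integrable: "integrand_hat \<nu> \<mu> \<theta> l absolutely_integrable_on {0..\<theta>}"
proof -
  have "weight \<mu> \<theta> l absolutely_integrable_on {0..\<theta>}"
    by (rule set_integrable_subset[OF weight_absolutely_integrable_symmetric]) (use \<theta> in auto)
  then show ?thesis
    unfolding integrand_hat_eq_weight [abs_def] Bessel_chi_hat_def
    by (rule absolutely_integrable_continuous_times[rotated]) (intro continuous_intros, auto)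
qed

text \<open>Folding the symmetric interval at 0 turns the integrand over [- \<theta>, \<theta>] into
  the sum of its values at u and - u.\<close>

lemma rhs_hat_eq_rhs_chi: "rhs_hat \<nu> \<mu> \<theta> l = rhs_chi \<nu> \<mu> \<theta> l"
proof -
  let ?f = "integrand_chi \<nu> \<mu> \<theta> l"
  have int: "?f integrable_on {- \<theta>..\<theta>}"
    using integrand_chi_absolutely_integrable by (rule set_lebesgue_integral_eq_integral(1))
  then have i1: "?f integrable_on {0..\<theta>}" and i2: "?f integrable_on {- \<theta>..0}"
    using \<theta> by (auto intro: integrable_on_subinterval)
  have i2': "(\<lambda>u. ?f (- u)) integrable_on {0..\<theta>}"
    using i2 Henstock_Kurzweil_Integration.integrable_reflect_real[where f = ?f and a = "- \<theta>" and b = 0] by simp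
  have "integral {0..\<theta>} (integrand_hat \<nu> \<mu> \<theta> l) = integral {0..\<theta>} ?f + integral {0..\<theta>} (\<lambda>u. ?f (- u))"
    unfolding integrand_hat_eq_chi [abs_def] by (rule integral_add[OF i1 i2'])
  also have "integral {0..\<theta>} (\<lambda>u. ?f (- u)) = integral {- \<theta>..0} ?f"
    using Henstock_Kurzweil_Integration.integral_reflect_real[where f = ?f and a = "- \<theta>" and b = 0] by simp
  also have "integral {0..\<theta>} ?f + integral {- \<theta>..0} ?f = integral {- \<theta>..\<theta>} ?f"
    using Henstock_Kurzweil_Integration.integral_combine[where a = "- \<theta>" and c = 0 and b = \<theta> and f = ?f] int \<theta>
    by (simp add: add.commute)
  finally show ?thesis by (simp add: rhs_hat_def rhs_chi_def)
qed

text \<open>The integral is a constant times that of \<open>bprod_integrand\<close> at y = \<xi>^2 /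
  4, and y may be replaced by 0. There the reflection formula produces sin (\<pi> \<nu>), which
  cancels the sine from the quotient for Y.\<close>

lemma rhs_hat_eq_cos_integral_not_Ints:
  assumes "\<nu> \<notin> \<int>"
  shows "rhs_hat \<nu> \<mu> \<theta> l = of_real (sqrt 2) / of_real pi * rGamma (- \<mu> - 1/2 + 1) *
    integral {0..\<theta>} (\<lambda>u. cos (\<nu> * of_real u) * complex_of_real (cos u - cos \<theta>) powr (- \<mu> - 1/2))"
proof -
  define \<sigma> where "\<sigma> = - \<mu> - 1/2"
  define S where "S = sin (complex_of_real pi * \<nu>)"
  define K where "K = - 2 / S * (exp (- l) * (exp (\<sigma> * l) * 2 powr ((1 + 2 * \<mu>) / 4)))"
  let ?y = "(exp l / 2)\<^sup>2"
  let ?I = "integral {0..\<theta>} (\<lambda>u. cos (\<nu> * of_real u) * complex_of_real (cos u - cos \<theta>) powr \<sigma>)"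
  have S: "S \<noteq> 0" using assms by (simp add: S_def sin_pi_eq_0_iff)
  have Re: "Re \<sigma> > - 1" using \<mu> by (simp add: \<sigma>_def)
  have "integral {0..\<theta>} (integrand_hat \<nu> \<mu> \<theta> l) = integral {0..\<theta>} (\<lambda>u. K * bprod_integrand \<nu> \<sigma> \<theta> ?y u)"
  proof (rule integral_cong)
    fix u assume "u \<in> {0..\<theta>}"
    then have "cos u - cos \<theta> \<ge> 0" using \<theta> by (intro cos_diff_nonneg) auto
    note w = weight_eq[OF this, of \<mu> l, folded \<sigma>_def]
    have "Bessel_chi_hat \<nu> l u = exp (- l) * (exp l * Bessel_chi_hat \<nu> l u)"
      by (simp add: exp_minus)
    also have "\<dots> = exp (- l) * (- 2 / S * (bprod' \<nu> ?y (of_real u) + bprod' \<nu> ?y (- of_real u)))"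
      unfolding Bessel_chi_hat_eq_bprod'[OF assms] S_def ..
    finally show "integrand_hat \<nu> \<mu> \<theta> l u = K * bprod_integrand \<nu> \<sigma> \<theta> ?y u"
      unfolding integrand_hat_eq_weight w K_def bprod_integrand_def by (simp only: mult_ac)
  qed
  also have "\<dots> = K * integral {0..\<theta>} (bprod_integrand \<nu> \<sigma> \<theta> ?y)"
    by simp
  also have "integral {0..\<theta>} (bprod_integrand \<nu> \<sigma> \<theta> ?y) = integral {0..\<theta>} (bprod_integrand \<nu> \<sigma> \<theta> 0)"
    by (rule integral_bprod_integrand_const[OF Re \<theta> weight_absolutely_integrable[OF Re \<theta>]])
  also have "bprod_integrand \<nu> \<sigma> \<theta> 0 = (\<lambda>u. (- 2 * S / of_real pi * rGamma (\<sigma> + 1)) *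
      (cos (\<nu> * of_real u) * complex_of_real (cos u - cos \<theta>) powr \<sigma>))"
  proof
    fix u
    have "rGamma (- \<nu>) * rGamma (\<nu> + 1) = - S / of_real pi"
      using rGamma_reflection_complex[of "- \<nu>"] by (simp add: S_def add.commute)
    then have b: "bprod' \<nu> 0 z = - S / of_real pi * exp (\<i> * \<nu> * z)" for z
      by (simp add: bprod'_def bes_0 mult_ac)
    have "exp (\<i> * \<nu> * of_real u) + exp (\<i> * \<nu> * (- of_real u)) = 2 * cos (\<nu> * of_real u)"
      by (simp add: cos_exp_eq mult_ac)
    then have "bprod' \<nu> 0 (of_real u) + bprod' \<nu> 0 (- of_real u) = - S / of_real pi * (2 * cos (\<nu> * of_real u))"
      unfolding b distrib_left[symmetric] by simp
    then show "bprod_integrand \<nu> \<sigma> \<theta> 0 u = (- 2 * S / of_real pi * rGamma (\<sigma> + 1)) *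
      (cos (\<nu> * of_real u) * complex_of_real (cos u - cos \<theta>) powr \<sigma>)"
      unfolding bprod_integrand_def by (simp add: bes_0 mult_ac)
  qed
  also have "integral {0..\<theta>} \<dots> = (- 2 * S / of_real pi * rGamma (\<sigma> + 1)) * ?I"
    by (rule integral_mult_right)
  finally have "rhs_hat \<nu> \<mu> \<theta> l = exp ((\<mu> + 3/2) * l) / 2 powr ((2 * \<mu> + 7) / 4) * (K * ((- 2 * S / of_real pi * rGamma (\<sigma> + 1)) * ?I))"
    by (simp add: rhs_hat_def)
  also have "\<dots> = (exp ((\<mu> + 3/2) * l) * exp (- l) * exp (\<sigma> * l)) * (4 * (2 powr ((1 + 2 * \<mu>) / 4) / 2 powr ((2 * \<mu> + 7) / 4))) *
      (rGamma (\<sigma> + 1) / of_real pi) * ?I"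
    using S by (simp add: K_def)
  \<comment> \<open>All powers of \<xi> cancel: \<mu> + 3/2 - 1 - \<mu> - 1/2 = 0.\<close>
  also have "exp ((\<mu> + 3/2) * l) * exp (- l) * exp (\<sigma> * l) = 1"
    unfolding exp_add[symmetric] by (simp add: \<sigma>_def field_simps)
  also have "4 * (2 powr ((1 + 2 * \<mu>) / 4) / 2 powr ((2 * \<mu> + 7) / 4)) = complex_of_real (sqrt 2)"
  proof -
    have "2 powr ((1 + 2 * \<mu>) / 4) / 2 powr ((2 * \<mu> + 7) / 4) = (2 :: complex) powr ((1 + 2 * \<mu>) / 4 - (2 * \<mu> + 7) / 4)"
      by (simp add: powr_diff)
    also have "(1 + 2 * \<mu>) / 4 - (2 * \<mu> + 7) / 4 = of_real (1/2 - 2)" by (simp add: field_simps)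
    also have "(2 :: complex) powr of_real (1/2 - 2) = of_real (2 powr (1/2 - 2))"
      using powr_of_real[of 2 "1/2 - 2"] by simp
    also have "2 powr (1/2 - 2) = sqrt 2 / (4 :: real)"
      by (subst powr_diff) (simp add: powr_half_sqrt)
    finally have q: "2 powr ((1 + 2 * \<mu>) / 4) / 2 powr ((2 * \<mu> + 7) / 4) = complex_of_real (sqrt 2 / 4)" .
    show ?thesis unfolding q by simp
  qed
  finally show ?thesis by (simp add: \<sigma>_def)
qed

end

section \<open>Passage to integer orders by continuity\<close>

text \<open>The convergent parameter sequence is bounded, so F is bounded by some M on a compact set
  and M |g| dominates all integrands.\<close>

lemma integral_continuous_family_tendsto:
  fixes F :: "complex \<Rightarrow> real \<Rightarrow> complex"
  assumes F: "continuous_on (UNIV \<times> {a..b}) (\<lambda>(s, u). F s u)"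
    and g: "g absolutely_integrable_on {a..b}" and s: "\<sigma> \<longlonglongrightarrow> s"
  shows "(\<lambda>k. integral {a..b} (\<lambda>u. F (\<sigma> k) u * g u)) \<longlonglongrightarrow> integral {a..b} (\<lambda>u. F s u * g u)"
proof -
  have "bounded (range \<sigma>)" using s by (rule convergent_imp_bounded)
  then obtain R where R: "\<And>k. norm (\<sigma> k) \<le> R" by (auto simp: bounded_iff)
  have cont: "continuous_on {a..b} (F t)" for t
  proof -
    have "continuous_on {a..b} (\<lambda>u. (t, u))" by (intro continuous_on_Pair continuous_on_const continuous_on_id)
    from continuous_on_compose2[OF F this] show ?thesis by auto
  qed
  have "compact ((\<lambda>(s, u). F s u) ` (cball 0 R \<times> {a..b}))"
    by (intro compact_continuous_image continuous_on_subset[OF F] compact_Times) auto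
  then obtain M where M: "\<And>s u. norm s \<le> R \<Longrightarrow> u \<in> {a..b} \<Longrightarrow> norm (F s u) \<le> M"
    by (fastforce dest!: compact_imp_bounded simp: bounded_iff)
  show ?thesis
  proof (rule dominated_convergence(2))
    show "(\<lambda>u. F (\<sigma> k) u * g u) integrable_on {a..b}" for k
      by (intro set_lebesgue_integral_eq_integral(1) absolutely_integrable_continuous_times cont g)
    show "(\<lambda>u. M * norm (g u)) integrable_on {a..b}"
      using g by (intro integrable_on_mult_right) (simp add: absolutely_integrable_on_def)
    show "norm (F (\<sigma> k) u * g u) \<le> M * norm (g u)" if "u \<in> {a..b}" for k u
      using M[OF R that] by (simp add: norm_mult mult_right_mono)
    show "(\<lambda>k. F (\<sigma> k) u * g u) \<longlonglongrightarrow> F s u * g u" if "u \<in> {a..b}" for u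
    proof -
      have "continuous_on UNIV (\<lambda>s. F s u)"
      proof -
        have "continuous_on UNIV (\<lambda>s::complex. (s, u))" by (intro continuous_on_Pair continuous_on_const continuous_on_id)
        moreover have "range (\<lambda>s::complex. (s, u)) \<subseteq> UNIV \<times> {a..b}" using that by auto
        ultimately show ?thesis using continuous_on_compose2[OF F] by fastforce
      qed
      from continuous_on_tendsto_compose[OF this s] show ?thesis by (intro tendsto_mult tendsto_const) auto
    qed
  qed
qed

lemma rhs_hat_eq_cos_integral:
  assumes \<mu>: "Re \<mu> < 1 / 2" and \<theta>: "0 < \<theta>" "\<theta> < pi"
  shows "rhs_hat \<nu> \<mu> \<theta> l = of_real (sqrt 2) / of_real pi * rGamma (- \<mu> - 1/2 + 1) *
    integral {0..\<theta>} (\<lambda>u. cos (\<nu> * of_real u) * complex_of_real (cos u - cos \<theta>) powr (- \<mu> - 1/2))"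
proof -
  \<comment> \<open>Non-integer orders tending to \<nu>: an integer is shifted by less than 1, any
    other \<nu> is kept, so one argument covers both cases.\<close>
  define N where "N k = \<nu> + of_real (if \<nu> \<in> \<int> then 1 / (real k + 2) else 0)" for k
  have N: "N k \<notin> \<int>" for k
  proof (cases "\<nu> \<in> \<int>")
    case True
    have "dist \<nu> (N k) = 1 / (real k + 2)" using True by (simp add: N_def dist_norm norm_divide del: of_real_divide of_real_add)
    then have "dist \<nu> (N k) < 1" "N k \<noteq> \<nu>" by auto
    then show ?thesis using not_Ints_near[OF True] by blast
  qed (simp add: N_def)
  have lim: "N \<longlonglongrightarrow> \<nu>"
  proof -
    have "(\<lambda>k. 1 / (real k + 2)) \<longlonglongrightarrow> 0" by real_asymp
    then have "(\<lambda>k. if \<nu> \<in> \<int> then 1 / (real k + 2) else 0) \<longlonglongrightarrow> 0" by (cases "\<nu> \<in> \<int>") auto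
    then have "N \<longlonglongrightarrow> \<nu> + of_real 0" unfolding N_def [abs_def] by (intro tendsto_intros)
    then show ?thesis by simp
  qed
  have w: "weight \<mu> \<theta> l absolutely_integrable_on {0..\<theta>}"
    by (rule set_integrable_subset[OF weight_absolutely_integrable_symmetric[OF assms]]) (use \<theta> in auto)
  have "(\<lambda>k. integral {0..\<theta>} (\<lambda>u. Bessel_chi_hat (N k) l u * weight \<mu> \<theta> l u)) \<longlonglongrightarrow>
      integral {0..\<theta>} (\<lambda>u. Bessel_chi_hat \<nu> l u * weight \<mu> \<theta> l u)"
    by (rule integral_continuous_family_tendsto[OF _ w lim])
       (unfold Bessel_chi_hat_def case_prod_beta', intro continuous_intros, auto)
  then have 1: "(\<lambda>k. rhs_hat (N k) \<mu> \<theta> l) \<longlonglongrightarrow> rhs_hat \<nu> \<mu> \<theta> l"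
    unfolding rhs_hat_def integrand_hat_eq_weight [abs_def] by (intro tendsto_mult tendsto_const)
  have Re: "Re (- \<mu> - 1/2) > - 1" using \<mu> by simp
  have "(\<lambda>k. integral {0..\<theta>} (\<lambda>u. cos (N k * of_real u) * complex_of_real (cos u - cos \<theta>) powr (- \<mu> - 1/2))) \<longlonglongrightarrow>
      integral {0..\<theta>} (\<lambda>u. cos (\<nu> * of_real u) * complex_of_real (cos u - cos \<theta>) powr (- \<mu> - 1/2))"
    by (rule integral_continuous_family_tendsto[OF _ weight_absolutely_integrable[OF Re \<theta>] lim])
       (unfold case_prod_beta', intro continuous_intros)
  then have "(\<lambda>k. rhs_hat (N k) \<mu> \<theta> l) \<longlonglongrightarrow> of_real (sqrt 2) / of_real pi * rGamma (- \<mu> - 1/2 + 1) *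
      integral {0..\<theta>} (\<lambda>u. cos (\<nu> * of_real u) * complex_of_real (cos u - cos \<theta>) powr (- \<mu> - 1/2))"
    unfolding rhs_hat_eq_cos_integral_not_Ints[OF assms N] by (intro tendsto_mult tendsto_const)
  with 1 show ?thesis by (rule LIMSEQ_unique)
qed

theorem theorem3:
  fixes \<xi> \<nu> \<mu> :: complex and \<theta> :: real
  assumes "Re \<mu> < 1 / 2" and "0 < \<theta>" and "\<theta> < pi"
  shows "let lhs = Ferrers_P (\<nu> - 1 / 2) \<mu> (cos \<theta>) /
                   (of_real (sqrt pi) * of_real (sin \<theta>) powr \<mu>)
         in if \<xi> = 0
            then (rhs_hat \<nu> \<mu> \<theta> \<longlongrightarrow> lhs) (filtercomap exp (at 0)) \<and>
                 (rhs_chi \<nu> \<mu> \<theta> \<longlongrightarrow> lhs) (filtercomap exp (at 0))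
            else \<forall>l. exp l = \<xi> \<longrightarrow>
                   integrand_hat \<nu> \<mu> \<theta> l absolutely_integrable_on {0..\<theta>} \<and>
                   integrand_chi \<nu> \<mu> \<theta> l absolutely_integrable_on {- \<theta>..\<theta>} \<and>
                   lhs = rhs_hat \<nu> \<mu> \<theta> l \<and> rhs_hat \<nu> \<mu> \<theta> l = rhs_chi \<nu> \<mu> \<theta> l"
proof -
  define lhs where "lhs = Ferrers_P (\<nu> - 1 / 2) \<mu> (cos \<theta>) / (of_real (sqrt pi) * of_real (sin \<theta>) powr \<mu>)"
  have hat: "rhs_hat \<nu> \<mu> \<theta> l = lhs" for l
    unfolding lhs_def Ferrers_P_eq_integral[OF assms] by (rule rhs_hat_eq_cos_integral[OF assms])
  have chi: "rhs_chi \<nu> \<mu> \<theta> l = lhs" for l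
    using rhs_hat_eq_rhs_chi[OF assms, of \<nu> l] hat[of l] by simp
  \<comment> \<open>As functions of the logarithm both right-hand sides are constant, so the limits
    for \<xi> = 0 are immediate.\<close>
  have "rhs_hat \<nu> \<mu> \<theta> = (\<lambda>_. lhs)" "rhs_chi \<nu> \<mu> \<theta> = (\<lambda>_. lhs)"
    by (simp_all add: fun_eq_iff hat chi)
  then show ?thesis
    unfolding Let_def lhs_def[symmetric]
    using integrand_hat_absolutely_integrable[OF assms] integrand_chi_absolutely_integrable[OF assms]
    by auto
qed

end
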